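(* Assume that $1<p<\infty$, $0<\tau<p$ and $\beta=1/\tau-1/p$. Write $\mathcal A_\infty^\alpha=\mathcal A_\infty^\alpha(L^p(S),\Phi)$. Then: (A) If the Bernstein inequality $\operatorname{BI}(\mathscr A,S,p,\tau)$ is not satisfied, then for all $\alpha>\beta$ and $\sigma$ given by $\alpha=1/\sigma-1/p$, the variation space $V_{\sigma,p}$ is not continuously embedded in $\mathcal A_\infty^\alpha$. (B) If the Bernstein inequality $\operatorname{BI}(\mathscr A,S,p,\tau)$ is satisfied, then for all $0<\alpha<\beta$ and $\sigma$ given by $\alpha=1/\sigma-1/p$, $V_{\sigma,p}$ is continuously embedded into $\mathcal A_\infty^\alpha$.
   Context: Setting. $(\Omega,\mathscr F,|\cdot|)$ is a probability space, $\nu\ge 2$ an integer, and $(\mathscr F_n)_{n\ge 0}$ a $\nu$-ary filtration: an increasing sequence of finite sub-$\sigma$-algebras of $\mathscr F$ with $\mathscr F_0=\{\emptyset,\Omega\}$, such that for each $n\ge1$ each atom of $\mathscr F_{n-1}$ is a union of at most $\nu$ atoms of $\mathscr F_n$; all atoms have positive measure. $\mathscr A_n$ is the set of atoms of $\mathscr F_n$ and $\mathscr A=\bigcup_n\mathscr A_n$. Elements of $\mathscr A$ are called atoms; nonempty differences $A\setminus B$ with $A,B\in\mathscr A$, $B\subsetneq A$, are called rings. $S$ is a finite-dimensional linear space of bounded $\mathscr F$-measurable scalar-valued functions on $\Omega$ for which there are constants $c_1,c_2\in(0,1]$ with $|\{\omega\in A:|f(\omega)|\ge c_1\|f\|_A\}|\ge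 c_2|A|$ for all $A\in\mathscr A$, $f\in S$, where $\|f\|_A$ is the $L^\infty$-norm of $f$ on $A$. For $R\in\mathscr F$, $S_R=\{f\mathbf 1_R:f\in S\}$. $\mathcal C=\{f\mathbf 1_A:f\in S,A\in\mathscr A\}$ and $L^p(S)$ is the closure of $\operatorname{span}\mathcal C$ in $L^p(\Omega)$. Local orthonormal system. $S_n$ is the space of functions coinciding on each atom of $\mathscr F_n$ with some element of $S$; $P_n$ is the orthogonal projection onto $S_n$ in $L^2$, $P_{-1}=0$. $\Phi=\bigcup_{n\ge0}\Phi_n$, where $\Phi_n$ is an orthonormal basis of the range of $P_n-P_{n-1}$, each element of $\Phi_n$ ($n\ge1$) being supported in a single atom of $\mathscr F_{n-1}$ (so that each element of $\Phi$ is a sum of at most $\nu$ elements of $\mathcal C$). It is assumed that for each $1<p<\infty$ the $L^p$-normalization of $\Phi$ is a greedy basis of $L^p(S)$ (i.e. $\|f-\mathscr G_mf\|_p$ is, up to a uniform constant, the best $m$-term approximation error, where $\mathscr G_m f$ is the sum of the $m$ terms of the basis expansion of $f$ with largest coefficients in absolute value) satisfying the $p$-Temlyakov property: $\|\sum_{n\in\Lambda}\psi_n\|_p\simeq(\operatorname{card}\Lambda)^{1/p}$ uniformly over finite index sets $\Lambda$, $(\psi_n)$ being the normalized system. Approximation space: for a linearly dense subset $\mathcal D\subset L^p(S)$, $\Sigma_n^{\mathcal D}$ is the set of linear combinations of $n$ elements of $\mathcal D$, $\sigma_n(f,\mathcal D)=\inf\{\|f-g\|_p:g\in\Sigma_n^{\mathcal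 D}\}$, and $\mathcal A_q^\alpha(L^p(S),\mathcal D)=\{f\in L^p(S):\|f\|_p+\|(2^{n\alpha}\sigma_{2^n}(f,\mathcal D))_{n\ge0}\|_{\ell^q}<\infty\}$ with this expression as quasi-norm. Variation space: $E_p(f,R)=\inf\{\|f-g\|_{L^p(R)}:g\in S_R\}$, $|f|_{V_{\sigma,p}}=\sup_\Pi\big(\sum_{R\in\Pi}E_p(f,R)^\sigma\big)^{1/\sigma}$, supremum over all finite collections $\Pi$ of pairwise disjoint atoms or rings; $V_{\sigma,p}=\{f\in L^p(S):\|f\|_{V_{\sigma,p}}:=\|f\|_p+|f|_{V_{\sigma,p}}<\infty\}$. Bernstein inequality: for $1<p<\infty$, $0<\tau<p$, $\beta=1/\tau-1/p$, $\operatorname{BI}(\mathscr A,S,p,\tau)$ is satisfied if there is a constant $C$ such that for all positive integers $n$ and all $f\in\Sigma_{2^n}^{\mathcal C}$ one has $\|f\|_{\mathcal A_\tau^\beta(L^p(S),\Phi)}\le C2^{n\beta}\|f\|_p$. *)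

theory Defs
  imports "HOL-Probability.Probability" "HOL-Library.Function_Algebras"
begin

section \<open>Scalars and linear structure\<close>

text \<open>
  The scalars are a type \<open>'k\<close> of sort \<open>{real_normed_field, euclidean_space}\<close>, which has the
  instances \<^typ>\<open>real\<close> and \<^typ>\<open>complex\<close> (and, up to isomorphism, no others). The formula
  below gives the complex conjugation on \<^typ>\<open>complex\<close> and the identity on \<^typ>\<open>real\<close>.
\<close>

definition scalar_cnj :: "'k::{real_normed_field, euclidean_space} \<Rightarrow> 'k" where
  "scalar_cnj x = of_real (2 * (x \<bullet> 1)) - x"

lemma scalar_cnj_real: "scalar_cnj (x::real) = x"
  by (simp add: scalar_cnj_def)

lemma scalar_cnj_complex: "scalar_cnj z = cnj z"
  by (simp add: scalar_cnj_def complex_eq_iff inner_complex_def)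

text \<open>
  Functions are actual functions on the type \<open>'a\<close>; their values outside \<open>space M\<close> never matter,
  and elements of \<open>L\<^sup>p\<close> are represented by functions, not by classes of functions.
\<close>

global_interpretation fun_vs: vector_space "\<lambda>(c::'k::field) (f::'a \<Rightarrow> 'k) \<omega>. c * f \<omega>"
  defines fun_span = fun_vs.span
  by unfold_locales (auto simp: fun_eq_iff algebra_simps)

section \<open>Lebesgue norms\<close>

definition lp_space :: "'a measure \<Rightarrow> real \<Rightarrow> ('a \<Rightarrow> 'k::{real_normed_field, euclidean_space}) set" where
  "lp_space M p = {f \<in> borel_measurable M. integrable M (\<lambda>\<omega>. norm (f \<omega>) powr p)}"

definition lp_norm :: "'a measure \<Rightarrow> real \<Rightarrow> 'a set \<Rightarrow> ('a \<Rightarrow> 'k::{real_normed_field, euclidean_space}) \<Rightarrow> real" where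
  "lp_norm M p R f = (LINT \<omega>:R|M. norm (f \<omega>) powr p) powr (1 / p)"

definition linf_norm :: "'a measure \<Rightarrow> 'a set \<Rightarrow> ('a \<Rightarrow> 'k::{real_normed_field, euclidean_space}) \<Rightarrow> real" where
  "linf_norm M A f = real_of_ereal (esssup (restrict_space M A) (\<lambda>\<omega>. ereal (norm (f \<omega>))))"

definition l2_inner :: "'a measure \<Rightarrow> ('a \<Rightarrow> 'k::{real_normed_field, euclidean_space}) \<Rightarrow> ('a \<Rightarrow> 'k) \<Rightarrow> 'k" where
  "l2_inner M f g = (LINT \<omega>|M. f \<omega> * scalar_cnj (g \<omega>))"

section \<open>Filtrations, atoms and rings\<close>

definition atoms_of :: "'a measure \<Rightarrow> 'a set set" where
  "atoms_of N = {A \<in> sets N. A \<noteq> {} \<and> (\<forall>B\<in>sets N. B \<subseteq> A \<longrightarrow> B = {} \<or> B = A)}"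

definition all_atoms :: "(nat \<Rightarrow> 'a measure) \<Rightarrow> 'a set set" where
  "all_atoms F = (\<Union>n. atoms_of (F n))"

definition rings_of :: "(nat \<Rightarrow> 'a measure) \<Rightarrow> 'a set set" where
  "rings_of F = {A - B | A B. A \<in> all_atoms F \<and> B \<in> all_atoms F \<and> B \<subset> A}"

text \<open>As in \<^locale>\<open>filtration\<close>, only the \<open>\<sigma>\<close>-algebra of \<open>F n\<close> is relevant, not its measure.\<close>

locale nary_filtration = prob_space M + filtration "space M" F
  for M :: "'a measure" and F :: "nat \<Rightarrow> 'a measure" +
  fixes \<nu> :: nat
  assumes nu_ge_2: "\<nu> \<ge> 2"
    and subalg: "\<And>n. subalgebra M (F n)"
    and finite_sets: "\<And>n. finite (sets (F n))"
    and sets_F_0: "sets (F 0) = {{}, space M}"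
    and nary: "\<And>n A. A \<in> atoms_of (F n) \<Longrightarrow>
      \<exists>\<U>\<subseteq>atoms_of (F (Suc n)). finite \<U> \<and> card \<U> \<le> \<nu> \<and> A = \<Union>\<U>"
    and atom_pos: "\<And>A. A \<in> all_atoms F \<Longrightarrow> measure M A > 0"

section \<open>The space \<open>S\<close> and the dictionary of its localizations\<close>

definition restrict_fun :: "'a set \<Rightarrow> ('a \<Rightarrow> 'k::{real_normed_field, euclidean_space}) \<Rightarrow> 'a \<Rightarrow> 'k" where
  "restrict_fun R f = (\<lambda>\<omega>. f \<omega> * indicator R \<omega>)"

definition stable_space :: "'a measure \<Rightarrow> (nat \<Rightarrow> 'a measure) \<Rightarrow> ('a \<Rightarrow> 'k::{real_normed_field, euclidean_space}) set \<Rightarrow> bool" where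
  "stable_space M F S \<longleftrightarrow>
     (\<exists>B. finite B \<and> S = fun_span B) \<and>
     (\<forall>f\<in>S. f \<in> borel_measurable M \<and> (\<exists>K. \<forall>\<omega>\<in>space M. norm (f \<omega>) \<le> K)) \<and>
     (\<exists>c\<^sub>1\<in>{0<..1}. \<exists>c\<^sub>2\<in>{0<..1}. \<forall>A\<in>all_atoms F. \<forall>f\<in>S.
        measure M {\<omega> \<in> A. norm (f \<omega>) \<ge> c\<^sub>1 * linf_norm M A f} \<ge> c\<^sub>2 * measure M A)"

definition local_dict :: "(nat \<Rightarrow> 'a measure) \<Rightarrow> ('a \<Rightarrow> 'k::{real_normed_field, euclidean_space}) set \<Rightarrow> ('a \<Rightarrow> 'k) set" where
  "local_dict F S = {restrict_fun A f | A f. A \<in> all_atoms F \<and> f \<in> S}"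

definition lp_S :: "'a measure \<Rightarrow> (nat \<Rightarrow> 'a measure) \<Rightarrow> ('a \<Rightarrow> 'k::{real_normed_field, euclidean_space}) set \<Rightarrow> real \<Rightarrow> ('a \<Rightarrow> 'k) set" where
  "lp_S M F S p = {f \<in> lp_space M p. \<forall>\<epsilon>>0. \<exists>g\<in>fun_span (local_dict F S).
      lp_norm M p (space M) (\<lambda>\<omega>. f \<omega> - g \<omega>) < \<epsilon>}"

section \<open>The local orthonormal system\<close>

definition S_level :: "(nat \<Rightarrow> 'a measure) \<Rightarrow> ('a \<Rightarrow> 'k::{real_normed_field, euclidean_space}) set \<Rightarrow> nat \<Rightarrow> ('a \<Rightarrow> 'k) set" where
  "S_level F S n = {f. \<forall>A\<in>atoms_of (F n). \<exists>g\<in>S. \<forall>\<omega>\<in>A. f \<omega> = g \<omega>}"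

text \<open>\<open>g\<close> is (a representative of) the \<open>L\<^sup>2\<close>-orthogonal projection of \<open>f\<close> onto \<open>V\<close>.\<close>

definition is_orth_proj :: "'a measure \<Rightarrow> ('a \<Rightarrow> 'k::{real_normed_field, euclidean_space}) set \<Rightarrow> ('a \<Rightarrow> 'k) \<Rightarrow> ('a \<Rightarrow> 'k) \<Rightarrow> bool" where
  "is_orth_proj M V f g \<longleftrightarrow> g \<in> V \<and> (\<forall>h\<in>V. l2_inner M (\<lambda>\<omega>. f \<omega> - g \<omega>) h = 0)"

text \<open>The range of \<open>P\<^sub>n - P\<^sub>n\<^sub>-\<^sub>1\<close> on \<open>L\<^sup>2\<close>; the convention \<open>P\<^sub>-\<^sub>1 = 0\<close> is projection onto \<open>{0}\<close>.\<close>

definition proj_diff_range :: "'a measure \<Rightarrow> (nat \<Rightarrow> 'a measure) \<Rightarrow> ('a \<Rightarrow> 'k::{real_normed_field, euclidean_space}) set \<Rightarrow> nat \<Rightarrow> ('a \<Rightarrow> 'k) set" where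
  "proj_diff_range M F S n = {(\<lambda>\<omega>. u \<omega> - v \<omega>) | u v. \<exists>f\<in>lp_space M 2.
      is_orth_proj M (S_level F S n) f u \<and>
      is_orth_proj M (if n = 0 then {0} else S_level F S (n - 1)) f v}"

definition orthonormal_basis :: "'a measure \<Rightarrow> ('a \<Rightarrow> 'k::{real_normed_field, euclidean_space}) set \<Rightarrow> ('a \<Rightarrow> 'k) set \<Rightarrow> bool" where
  "orthonormal_basis M V B \<longleftrightarrow> B \<subseteq> V \<and>
     (\<forall>\<phi>\<in>B. \<forall>\<psi>\<in>B. l2_inner M \<phi> \<psi> = (if \<phi> = \<psi> then 1 else 0)) \<and>
     (\<forall>f\<in>V. \<exists>g\<in>fun_span B. AE \<omega> in M. f \<omega> = g \<omega>)"

definition local_orthonormal_system :: "'a measure \<Rightarrow> (nat \<Rightarrow> 'a measure) \<Rightarrow> ('a \<Rightarrow> 'k::{real_normed_field, euclidean_space}) set \<Rightarrow> (nat \<Rightarrow> ('a \<Rightarrow> 'k) set) \<Rightarrow> bool" where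
  "local_orthonormal_system M F S \<Phi> \<longleftrightarrow>
     (\<forall>n. orthonormal_basis M (proj_diff_range M F S n) (\<Phi> n)) \<and>
     (\<forall>n\<ge>1. \<forall>\<phi>\<in>\<Phi> n. \<exists>A\<in>atoms_of (F (n - 1)). \<forall>\<omega>\<in>space M - A. \<phi> \<omega> = 0)"

section \<open>Best approximation and approximation spaces\<close>

definition n_term :: "('a \<Rightarrow> 'k::{real_normed_field, euclidean_space}) set \<Rightarrow> nat \<Rightarrow> ('a \<Rightarrow> 'k) set" where
  "n_term D n = {g. \<exists>T\<subseteq>D. finite T \<and> card T \<le> n \<and> g \<in> fun_span T}"

definition best_approx :: "'a measure \<Rightarrow> real \<Rightarrow> ('a \<Rightarrow> 'k::{real_normed_field, euclidean_space}) set \<Rightarrow> nat \<Rightarrow> ('a \<Rightarrow> 'k) \<Rightarrow> real" where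
  "best_approx M p D n f = (INF g\<in>n_term D n. lp_norm M p (space M) (\<lambda>\<omega>. f \<omega> - g \<omega>))"

text \<open>Meant for exponents \<open>r > 0\<close>.\<close>

definition ennreal_powr :: "ennreal \<Rightarrow> real \<Rightarrow> ennreal" where
  "ennreal_powr x r = (if x = \<infinity> then \<infinity> else ennreal (enn2real x powr r))"

definition lq_norm :: "ennreal \<Rightarrow> (nat \<Rightarrow> real) \<Rightarrow> ennreal" where
  "lq_norm q a = (if q = \<infinity> then (SUP n. ennreal \<bar>a n\<bar>)
     else ennreal_powr (\<Sum>n. ennreal (\<bar>a n\<bar> powr enn2real q)) (1 / enn2real q))"

definition approx_norm :: "'a measure \<Rightarrow> real \<Rightarrow> ('a \<Rightarrow> 'k::{real_normed_field, euclidean_space}) set \<Rightarrow> real \<Rightarrow> ennreal \<Rightarrow> ('a \<Rightarrow> 'k) \<Rightarrow> ennreal" where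
  "approx_norm M p D \<alpha> q f = ennreal (lp_norm M p (space M) f) +
     lq_norm q (\<lambda>n. 2 powr (real n * \<alpha>) * best_approx M p D (2 ^ n) f)"

definition approx_space :: "'a measure \<Rightarrow> (nat \<Rightarrow> 'a measure) \<Rightarrow> ('a \<Rightarrow> 'k::{real_normed_field, euclidean_space}) set \<Rightarrow> real \<Rightarrow> ('a \<Rightarrow> 'k) set \<Rightarrow> real \<Rightarrow> ennreal \<Rightarrow> ('a \<Rightarrow> 'k) set" where
  "approx_space M F S p D \<alpha> q = {f \<in> lp_S M F S p. approx_norm M p D \<alpha> q f < \<infinity>}"

section \<open>Greedy bases and the Temlyakov property\<close>

text \<open>
  Sequences are indexed by a set \<open>I\<close> of natural numbers, in increasing order. Finite \<open>I\<close> is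
  needed when \<open>L\<^sup>p(S)\<close> is finite-dimensional.
\<close>

definition lp_expansion :: "'a measure \<Rightarrow> real \<Rightarrow> nat set \<Rightarrow> (nat \<Rightarrow> 'a \<Rightarrow> 'k::{real_normed_field, euclidean_space}) \<Rightarrow> (nat \<Rightarrow> 'k) \<Rightarrow> ('a \<Rightarrow> 'k) \<Rightarrow> bool" where
  "lp_expansion M p I \<psi> c f \<longleftrightarrow>
     (\<lambda>n. lp_norm M p (space M) (\<lambda>\<omega>. f \<omega> - (\<Sum>i\<in>I \<inter> {..<n}. c i * \<psi> i \<omega>))) \<longlonglongrightarrow> 0"

definition schauder_basis :: "'a measure \<Rightarrow> real \<Rightarrow> ('a \<Rightarrow> 'k::{real_normed_field, euclidean_space}) set \<Rightarrow> nat set \<Rightarrow> (nat \<Rightarrow> 'a \<Rightarrow> 'k) \<Rightarrow> bool" where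
  "schauder_basis M p V I \<psi> \<longleftrightarrow> (\<forall>i\<in>I. \<psi> i \<in> V) \<and>
     (\<forall>f\<in>V. \<exists>!c. (\<forall>i. i \<notin> I \<longrightarrow> c i = 0) \<and> lp_expansion M p I \<psi> c f)"

text \<open>
  \<open>\<Lambda>\<close> selects the \<open>m\<close> terms of a greedy sum. Nothing is required about the choice
  in case of ties, so that any tie-breaking rule is admitted.
\<close>

definition greedy_set :: "nat set \<Rightarrow> (nat \<Rightarrow> 'k::{real_normed_field, euclidean_space}) \<Rightarrow> nat \<Rightarrow> nat set \<Rightarrow> bool" where
  "greedy_set I c m \<Lambda> \<longleftrightarrow> \<Lambda> \<subseteq> I \<and> finite \<Lambda> \<and> card \<Lambda> = m \<and>
     (\<forall>i\<in>\<Lambda>. \<forall>j\<in>I - \<Lambda>. norm (c j) \<le> norm (c i))"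

definition greedy_basis :: "'a measure \<Rightarrow> real \<Rightarrow> ('a \<Rightarrow> 'k::{real_normed_field, euclidean_space}) set \<Rightarrow> nat set \<Rightarrow> (nat \<Rightarrow> 'a \<Rightarrow> 'k) \<Rightarrow> bool" where
  "greedy_basis M p V I \<psi> \<longleftrightarrow> schauder_basis M p V I \<psi> \<and>
     (\<exists>K. \<forall>f\<in>V. \<forall>c. lp_expansion M p I \<psi> c f \<longrightarrow>
        (\<forall>m. (finite I \<longrightarrow> m \<le> card I) \<longrightarrow>
          (\<exists>\<Lambda>. greedy_set I c m \<Lambda> \<and>
             lp_norm M p (space M) (\<lambda>\<omega>. f \<omega> - (\<Sum>i\<in>\<Lambda>. c i * \<psi> i \<omega>))
               \<le> K * best_approx M p (\<psi> ` I) m f)))"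

definition temlyakov_property :: "'a measure \<Rightarrow> real \<Rightarrow> nat set \<Rightarrow> (nat \<Rightarrow> 'a \<Rightarrow> 'k::{real_normed_field, euclidean_space}) \<Rightarrow> bool" where
  "temlyakov_property M p I \<psi> \<longleftrightarrow>
     (\<exists>K\<^sub>1>0. \<exists>K\<^sub>2>0. \<forall>\<Lambda>\<subseteq>I. finite \<Lambda> \<longrightarrow>
        K\<^sub>1 * real (card \<Lambda>) powr (1 / p) \<le> lp_norm M p (space M) (\<lambda>\<omega>. \<Sum>i\<in>\<Lambda>. \<psi> i \<omega>) \<and>
        lp_norm M p (space M) (\<lambda>\<omega>. \<Sum>i\<in>\<Lambda>. \<psi> i \<omega>) \<le> K\<^sub>2 * real (card \<Lambda>) powr (1 / p))"

definition lp_normalize :: "'a measure \<Rightarrow> real \<Rightarrow> ('a \<Rightarrow> 'k::{real_normed_field, euclidean_space}) \<Rightarrow> 'a \<Rightarrow> 'k" where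
  "lp_normalize M p \<phi> = (\<lambda>\<omega>. \<phi> \<omega> / of_real (lp_norm M p (space M) \<phi>))"

text \<open>
  A countable system of functions is a greedy basis if it is one in some enumeration. Greedy
  bases are unconditional, so the choice of the enumeration is immaterial.
\<close>

definition greedy_temlyakov_system :: "'a measure \<Rightarrow> real \<Rightarrow> ('a \<Rightarrow> 'k::{real_normed_field, euclidean_space}) set \<Rightarrow> ('a \<Rightarrow> 'k) set \<Rightarrow> bool" where
  "greedy_temlyakov_system M p V D \<longleftrightarrow>
     (\<exists>I e. bij_betw e I D \<and>
        greedy_basis M p V I (\<lambda>i. lp_normalize M p (e i)) \<and>
        temlyakov_property M p I (\<lambda>i. lp_normalize M p (e i)))"

section \<open>Variation spaces\<close>

definition local_error :: "'a measure \<Rightarrow> ('a \<Rightarrow> 'k::{real_normed_field, euclidean_space}) set \<Rightarrow> real \<Rightarrow> ('a \<Rightarrow> 'k) \<Rightarrow> 'a set \<Rightarrow> real" where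
  "local_error M S p f R = (INF g\<in>restrict_fun R ` S. lp_norm M p R (\<lambda>\<omega>. f \<omega> - g \<omega>))"

definition var_seminorm :: "'a measure \<Rightarrow> (nat \<Rightarrow> 'a measure) \<Rightarrow> ('a \<Rightarrow> 'k::{real_normed_field, euclidean_space}) set \<Rightarrow> real \<Rightarrow> real \<Rightarrow> ('a \<Rightarrow> 'k) \<Rightarrow> ennreal" where
  "var_seminorm M F S \<sigma> p f =
     (SUP \<P>\<in>{\<P>. finite \<P> \<and> \<P> \<subseteq> all_atoms F \<union> rings_of F \<and> disjoint \<P>}.
        ennreal ((\<Sum>R\<in>\<P>. local_error M S p f R powr \<sigma>) powr (1 / \<sigma>)))"

definition var_norm :: "'a measure \<Rightarrow> (nat \<Rightarrow> 'a measure) \<Rightarrow> ('a \<Rightarrow> 'k::{real_normed_field, euclidean_space}) set \<Rightarrow> real \<Rightarrow> real \<Rightarrow> ('a \<Rightarrow> 'k) \<Rightarrow> ennreal" where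
  "var_norm M F S \<sigma> p f = ennreal (lp_norm M p (space M) f) + var_seminorm M F S \<sigma> p f"

definition var_space :: "'a measure \<Rightarrow> (nat \<Rightarrow> 'a measure) \<Rightarrow> ('a \<Rightarrow> 'k::{real_normed_field, euclidean_space}) set \<Rightarrow> real \<Rightarrow> real \<Rightarrow> ('a \<Rightarrow> 'k) set" where
  "var_space M F S \<sigma> p = {f \<in> lp_S M F S p. var_norm M F S \<sigma> p f < \<infinity>}"

section \<open>Continuous embeddings and the Bernstein inequality\<close>

text \<open>Continuous embedding of the quasi-normed space \<open>(X, NX)\<close> into \<open>(Y, NY)\<close>.\<close>

definition cont_embedded :: "'b set \<Rightarrow> ('b \<Rightarrow> ennreal) \<Rightarrow> 'b set \<Rightarrow> ('b \<Rightarrow> ennreal) \<Rightarrow> bool" where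
  "cont_embedded X NX Y NY \<longleftrightarrow> X \<subseteq> Y \<and> (\<exists>C::real. \<forall>f\<in>X. NY f \<le> ennreal C * NX f)"

text \<open>\<open>D\<close> is the orthonormal system used for the approximation space.\<close>

definition bernstein_inequality :: "'a measure \<Rightarrow> (nat \<Rightarrow> 'a measure) \<Rightarrow> ('a \<Rightarrow> 'k::{real_normed_field, euclidean_space}) set \<Rightarrow> ('a \<Rightarrow> 'k) set \<Rightarrow> real \<Rightarrow> real \<Rightarrow> bool" where
  "bernstein_inequality M F S D p \<tau> \<longleftrightarrow>
     (let \<beta> = 1 / \<tau> - 1 / p in
      \<exists>C::real. \<forall>n\<ge>1. \<forall>f\<in>n_term (local_dict F S) (2 ^ n).
        approx_norm M p D \<beta> (ennreal \<tau>) f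
          \<le> ennreal (C * 2 powr (real n * \<beta>) * lp_norm M p (space M) f))"

end

theory Submission
  imports Defs
begin

text \<open>
  Let \<open>\<C>\<close> denote the dictionary \<open>local_dict F S\<close> and \<open>D\<close> the
  orthonormal system. For every exponent \<open>\<alpha> = 1 / \<sigma> - 1 / p > 0\<close> the variation space is tied to
  \<open>\<C>\<close> by a pair of matching estimates.

  \<^item> Direct estimate (\<open>jackson_inequality\<close>): a function of variation at most \<open>w\<close> is approximated by \<open>2 ^ j\<close> elements
  of \<open>\<C>\<close> up to a multiple of \<open>w * 2 powr (- j * \<alpha>)\<close>. The pieces are found by cutting the tree of atoms
  into atoms and rings whose local errors are below a threshold \<open>\<epsilon>\<close>. Rings keep the number of
  pieces small: along a chain of atoms without branching, all the material that splits off is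
  collected in one ring until its error reaches \<open>\<epsilon>\<close>. In this way the number of pieces, unless a
  single one suffices, is at most a multiple of the number of certain disjoint sets with error at
  least \<open>\<epsilon>\<close>, which the variation bounds.

  \<^item> Inverse estimate (\<open>var_seminorm_le_n_term\<close>): a sum of \<open>N\<close> elements of \<open>\<C>\<close> has variation at most
  \<open>N powr \<alpha>\<close> times its norm, because among disjoint atoms and rings at most \<open>N\<close> can see a jump of
  such a sum, and Hoelder's inequality does the rest.

  If the variation space is embedded into the approximation space of order \<open>\<alpha> > \<beta>\<close> with respect to
  \<open>D\<close>, the inverse estimate turns the embedding into a Bernstein inequality of order \<open>\<alpha>\<close> for sums of
  elements of \<open>\<C>\<close>. As \<open>\<alpha>\<close> is strictly larger than \<open>\<beta>\<close>, it implies the Bernstein inequality for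
  \<open>\<beta>\<close> and \<open>\<tau>\<close> (\<open>embedding_imp_bernstein\<close>).

  If conversely the Bernstein inequality holds and \<open>0 < \<alpha> < \<beta>\<close>, then a function of finite variation
  is expanded into the differences of its approximants by \<open>2 ^ j\<close> elements of \<open>\<C>\<close>. The Bernstein
  inequality says how well each difference is approximated from \<open>D\<close>, and a suitable distribution of
  the terms among the differences gives the order \<open>\<alpha>\<close> (\<open>bernstein_imp_embedding\<close>).
\<close>

section \<open>The $L^p$-norm\<close>

text \<open>
  The pointwise form of Minkowski's inequality: \<open>(x + y) / (a + b)\<close> is the convex combination of
  \<open>x / a\<close> and \<open>y / b\<close> with weights \<open>a / (a + b)\<close> and \<open>b / (a + b)\<close>. If \<open>\<integral>x powr p \<le> a powr p\<close> and
  \<open>\<integral>y powr p \<le> b powr p\<close>, integration makes the two summands on the right at most these weights,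
  whose sum is \<open>1\<close>.
\<close>

lemma convex_powr_sum_le:
  fixes x y a b p :: real
  assumes p: "p \<ge> 1" and "x \<ge> 0" "y \<ge> 0" "a > 0" "b > 0"
  shows "(x + y) powr p \<le> (a + b) powr p * (a / (a + b) * (x powr p / a powr p) + b / (a + b) * (y powr p / b powr p))"
proof -
  define t where "t = a / (a + b)"
  have t: "0 < t" "t < 1" "1 - t = b / (a + b)" using assms by (auto simp: t_def field_simps)
  have le: "s powr p \<le> s" if "0 < s" "s < 1" for s :: real
    using powr_mono'[of 1 p s] that p by simp
  have "(t * (x / a) + (1 - t) * (y / b)) powr p \<le> t * (x / a) powr p + (1 - t) * (y / b) powr p"
  proof (cases "x = 0 \<or> y = 0")
    case True
    then show ?thesis
    proof
      assume "x = 0"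
      have "((1 - t) * (y / b)) powr p \<le> (1 - t) * (y / b) powr p"
        unfolding powr_mult using le[of "1 - t"] t(1,2) by (intro mult_right_mono) auto
      then show ?thesis using \<open>x = 0\<close> p by simp
    next
      assume "y = 0"
      have "(t * (x / a)) powr p \<le> t * (x / a) powr p"
        unfolding powr_mult using le[of t] t by (intro mult_right_mono) auto
      then show ?thesis using \<open>y = 0\<close> p by simp
    qed
  next
    case False
    then have "x / a > 0" "y / b > 0" using assms by auto
    then show ?thesis
      using convex_onD[OF powr_convex[OF p], of "1 - t" "x / a" "y / b"] t(1,2) by simp
  qed
  also have "t * (x / a) + (1 - t) * (y / b) = (x + y) / (a + b)"
    unfolding t(3) unfolding t_def using assms by (simp add: add_divide_distrib)
  finally have "((x + y) / (a + b)) powr p \<le> t * (x / a) powr p + (1 - t) * (y / b) powr p" .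
  then have "(a + b) powr p * ((x + y) / (a + b)) powr p
      \<le> (a + b) powr p * (t * (x / a) powr p + (1 - t) * (y / b) powr p)"
    by (intro mult_left_mono) auto
  moreover have "(a + b) powr p * ((x + y) / (a + b)) powr p = (x + y) powr p"
    using assms by (simp add: powr_divide)
  ultimately show ?thesis using assms t by (simp add: powr_divide t_def)
qed

lemma lp_spaceD:
  assumes "f \<in> lp_space M p"
  shows "f \<in> borel_measurable M" "integrable M (\<lambda>\<omega>. norm (f \<omega>) powr p)"
  using assms by (auto simp: lp_space_def)

lemma lp_norm_nonneg [simp]: "0 \<le> lp_norm M p R f"
  by (simp add: lp_norm_def)

lemma lp_norm_minus_commute:
  "lp_norm M p R (\<lambda>\<omega>. f \<omega> - g \<omega>) = lp_norm M p R (\<lambda>\<omega>. g \<omega> - f \<omega>)"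
  by (simp add: lp_norm_def norm_minus_commute)

lemma set_integral_norm_powr_nonneg:
  "0 \<le> (LINT \<omega>:R|M. norm (f \<omega>) powr p)"
  unfolding set_lebesgue_integral_def by (rule Bochner_Integration.integral_nonneg) auto

lemma lp_norm_powr:
  assumes "p > 0"
  shows "lp_norm M p R f powr p = (LINT \<omega>:R|M. norm (f \<omega>) powr p)"
  using assms set_integral_norm_powr_nonneg[of M R f p] by (simp add: lp_norm_def powr_powr)

lemma lp_norm_le_iff:
  assumes "p > 0" "a \<ge> 0"
  shows "lp_norm M p R f \<le> a \<longleftrightarrow> (LINT \<omega>:R|M. norm (f \<omega>) powr p) \<le> a powr p"
proof -
  have "lp_norm M p R f \<le> a \<longleftrightarrow> lp_norm M p R f powr p \<le> a powr p"
    using powr_less_mono2[of p a "lp_norm M p R f"] powr_mono2[of p "lp_norm M p R f" a] assms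
      lp_norm_nonneg[of M p R f] by linarith
  then show ?thesis using assms by (simp add: lp_norm_powr)
qed

lemma lp_space_bounded:
  fixes f :: "'a \<Rightarrow> 'k::{real_normed_field, euclidean_space}"
  assumes "finite_measure M" "f \<in> borel_measurable M" "\<And>\<omega>. \<omega> \<in> space M \<Longrightarrow> norm (f \<omega>) \<le> K" "p \<ge> 0"
  shows "f \<in> lp_space M p"
proof -
  interpret finite_measure M by fact
  have "integrable M (\<lambda>\<omega>. norm (f \<omega>) powr p)"
    using assms by (intro integrable_const_bound[where B = "K powr p"] AE_I2) (auto intro: powr_mono2)
  then show ?thesis using assms by (simp add: lp_space_def)
qed

lemma
  fixes f g :: "'a \<Rightarrow> 'k::{real_normed_field, euclidean_space}"
  assumes f: "f \<in> lp_space M p" and g: "g \<in> lp_space M p" and p: "p \<ge> 1"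
  shows lp_space_add: "(\<lambda>\<omega>. f \<omega> + g \<omega>) \<in> lp_space M p"
    and lp_norm_triangle: "lp_norm M p (space M) (\<lambda>\<omega>. f \<omega> + g \<omega>) \<le> lp_norm M p (space M) f + lp_norm M p (space M) g"
proof -
  note [measurable] = lp_spaceD(1)[OF f] lp_spaceD(1)[OF g]
  note int = lp_spaceD(2)[OF f] lp_spaceD(2)[OF g]
  define H where "H a b \<omega> = (a + b) powr p * (a / (a + b) * (norm (f \<omega>) powr p / a powr p)
      + b / (a + b) * (norm (g \<omega>) powr p / b powr p))" for a b \<omega>
  have intH: "integrable M (H a b)" for a b
    unfolding H_def using int by simp
  have le: "norm (f \<omega> + g \<omega>) powr p \<le> H a b \<omega>" if "a > 0" "b > 0" for a b \<omega>
  proof -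
    have "norm (f \<omega> + g \<omega>) powr p \<le> (norm (f \<omega>) + norm (g \<omega>)) powr p"
      using p by (intro powr_mono2 norm_triangle_ineq) auto
    also have "\<dots> \<le> H a b \<omega>"
      unfolding H_def using p that by (intro convex_powr_sum_le) auto
    finally show ?thesis .
  qed
  have fg: "integrable M (\<lambda>\<omega>. norm (f \<omega> + g \<omega>) powr p)"
    by (rule Bochner_Integration.integrable_bound[OF intH[of 1 1]])
      (auto intro!: AE_I2 order_trans[OF le[of 1 1] abs_ge_self])
  then show sp: "(\<lambda>\<omega>. f \<omega> + g \<omega>) \<in> lp_space M p"
    by (simp add: lp_space_def)
  let ?n = "lp_norm M p (space M)"
  show "?n (\<lambda>\<omega>. f \<omega> + g \<omega>) \<le> ?n f + ?n g"
  proof (rule field_le_epsilon)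
    fix e :: real assume "e > 0"
    \<comment> \<open>The surplus \<open>e / 2\<close> makes \<open>a\<close> and \<open>b\<close> positive even when a norm vanishes.\<close>
    define a b where "a = ?n f + e / 2" and "b = ?n g + e / 2"
    have ab: "a > 0" "b > 0" using \<open>e > 0\<close> lp_norm_nonneg[of M p "space M" f] lp_norm_nonneg[of M p "space M" g]
      unfolding a_def b_def by linarith+
    have I: "(LINT \<omega>|M. norm (f \<omega>) powr p) \<le> a powr p" "(LINT \<omega>|M. norm (g \<omega>) powr p) \<le> b powr p"
      using lp_norm_le_iff[of p a M "space M" f] lp_norm_le_iff[of p b M "space M" g] ab p \<open>e > 0\<close> int
      by (auto simp: set_integral_space a_def b_def)
    have "(LINT \<omega>|M. norm (f \<omega> + g \<omega>) powr p) \<le> (LINT \<omega>|M. H a b \<omega>)"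
      using le[OF ab] by (intro integral_mono fg intH)
    also have "\<dots> = (a + b) powr p * (a / (a + b) * ((LINT \<omega>|M. norm (f \<omega>) powr p) / a powr p)
        + b / (a + b) * ((LINT \<omega>|M. norm (g \<omega>) powr p) / b powr p))"
      unfolding H_def using int by simp
    also have "\<dots> \<le> (a + b) powr p * (a / (a + b) * 1 + b / (a + b) * 1)"
      using I ab by (intro mult_left_mono add_mono) (auto simp: divide_le_eq_1)
    also have "\<dots> = (a + b) powr p" using ab by (simp flip: add_divide_distrib)
    finally have "?n (\<lambda>\<omega>. f \<omega> + g \<omega>) \<le> a + b"
      using ab p fg by (subst lp_norm_le_iff) (auto simp: set_integral_space)
    then show "?n (\<lambda>\<omega>. f \<omega> + g \<omega>) \<le> ?n f + ?n g + e" by (simp add: a_def b_def)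
  qed
qed

lemma lp_space_scale:
  fixes f :: "'a \<Rightarrow> 'k::{real_normed_field, euclidean_space}"
  assumes "f \<in> lp_space M p"
  shows "(\<lambda>\<omega>. c * f \<omega>) \<in> lp_space M p"
  using lp_spaceD[OF assms] by (auto simp: lp_space_def norm_mult powr_mult)

lemma lp_space_diff:
  fixes f g :: "'a \<Rightarrow> 'k::{real_normed_field, euclidean_space}"
  assumes "f \<in> lp_space M p" "g \<in> lp_space M p" "p \<ge> 1"
  shows "(\<lambda>\<omega>. f \<omega> - g \<omega>) \<in> lp_space M p"
  using lp_space_add[OF assms(1) lp_space_scale[OF assms(2), of "-1"] assms(3)] by simp

lemma lp_space_zero: "(\<lambda>_. 0) \<in> lp_space M p"
  by (simp add: lp_space_def)

lemma lp_norm_triangle_diff: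
  fixes f g h :: "'a \<Rightarrow> 'k::{real_normed_field, euclidean_space}"
  assumes "f \<in> lp_space M p" "g \<in> lp_space M p" "h \<in> lp_space M p" "p \<ge> 1"
  shows "lp_norm M p (space M) (\<lambda>\<omega>. f \<omega> - h \<omega>)
    \<le> lp_norm M p (space M) (\<lambda>\<omega>. f \<omega> - g \<omega>) + lp_norm M p (space M) (\<lambda>\<omega>. g \<omega> - h \<omega>)"
  using lp_norm_triangle[OF lp_space_diff[OF assms(1,2,4)] lp_space_diff[OF assms(2,3,4)] assms(4)] by simp

lemma set_integrable_lp:
  assumes "f \<in> lp_space M p" "R \<in> sets M"
  shows "set_integrable M R (\<lambda>\<omega>. norm (f \<omega>) powr p)"
  unfolding set_integrable_def using lp_spaceD[OF assms(1)] assms(2)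
  by (intro integrable_mult_indicator) auto

lemma lp_norm_subset:
  assumes "f \<in> lp_space M p" "A \<in> sets M" "B \<in> sets M" "A \<subseteq> B" "p > 0"
  shows "lp_norm M p A f \<le> lp_norm M p B f"
proof -
  have "(LINT \<omega>:A|M. norm (f \<omega>) powr p) \<le> (LINT \<omega>:B|M. norm (f \<omega>) powr p)"
    unfolding set_lebesgue_integral_def
    using assms set_integrable_lp[OF assms(1)] unfolding set_integrable_def
    by (intro integral_mono) (auto split: split_indicator)
  then show ?thesis unfolding lp_norm_def using assms set_integral_norm_powr_nonneg
    by (intro powr_mono2) auto
qed

lemma fun_span_subset_lp_space:
  fixes D :: "('a \<Rightarrow> 'k::{real_normed_field, euclidean_space}) set"
  assumes D: "D \<subseteq> lp_space M p" and p: "p \<ge> 1"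
  shows "fun_span D \<subseteq> lp_space M p"
proof (rule fun_vs.span_minimal[OF D])
  show "fun_vs.subspace (lp_space M p :: ('a \<Rightarrow> 'k) set)"
    unfolding fun_vs.subspace_def using lp_space_add[OF _ _ p] lp_space_scale lp_space_zero
    by (auto simp: plus_fun_def zero_fun_def)
qed

section \<open>Best approximation by sums of few terms\<close>

lemma zero_in_n_term: "(\<lambda>_. 0) \<in> n_term D n"
proof -
  have "(\<lambda>_. 0) \<in> fun_span {}" using fun_vs.span_zero[of "{}"] by (simp add: zero_fun_def)
  then show ?thesis unfolding n_term_def by (intro CollectI exI[of _ "{}"]) simp
qed

lemma n_term_mono: "m \<le> n \<Longrightarrow> n_term D m \<subseteq> n_term D n"
  unfolding n_term_def by (blast intro: order_trans)

lemma n_term_subset_span: "n_term D n \<subseteq> fun_span D"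
  unfolding n_term_def using fun_vs.span_mono by blast

lemma
  assumes "f \<in> n_term D m" "g \<in> n_term D n"
  shows n_term_add: "(\<lambda>\<omega>. f \<omega> + g \<omega>) \<in> n_term D (m + n)"
    and n_term_diff: "(\<lambda>\<omega>. f \<omega> - g \<omega>) \<in> n_term D (m + n)"
proof -
  obtain T U where *: "T \<subseteq> D" "finite T" "card T \<le> m" "f \<in> fun_span T"
     "U \<subseteq> D" "finite U" "card U \<le> n" "g \<in> fun_span U"
    using assms unfolding n_term_def by blast
  have "card (T \<union> U) \<le> m + n" using card_Un_le[of T U] * by linarith
  moreover have "f \<in> fun_span (T \<union> U)" "g \<in> fun_span (T \<union> U)"
    using * fun_vs.span_mono[of T "T \<union> U"] fun_vs.span_mono[of U "T \<union> U"] by auto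
  then have "f + g \<in> fun_span (T \<union> U)" "f - g \<in> fun_span (T \<union> U)"
    by (auto intro: fun_vs.span_add fun_vs.span_diff)
  ultimately show "(\<lambda>\<omega>. f \<omega> + g \<omega>) \<in> n_term D (m + n)" "(\<lambda>\<omega>. f \<omega> - g \<omega>) \<in> n_term D (m + n)"
    unfolding n_term_def plus_fun_def fun_diff_def using *
    by (auto intro!: exI[of _ "T \<union> U"])
qed

lemma n_term_base: "f \<in> D \<Longrightarrow> f \<in> n_term D 1"
  unfolding n_term_def by (intro CollectI exI[of _ "{f}"]) (auto intro: fun_vs.span_base)

lemma best_approx_bdd_below: "bdd_below ((\<lambda>g. lp_norm M p (space M) (\<lambda>\<omega>. f \<omega> - g \<omega>)) ` n_term D n)"
  by (rule bdd_belowI[of _ 0]) auto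

lemma best_approx_le:
  "g \<in> n_term D n \<Longrightarrow> best_approx M p D n f \<le> lp_norm M p (space M) (\<lambda>\<omega>. f \<omega> - g \<omega>)"
  unfolding best_approx_def by (rule cINF_lower[OF best_approx_bdd_below])

lemma best_approx_le_norm: "best_approx M p D n f \<le> lp_norm M p (space M) f"
  using best_approx_le[OF zero_in_n_term] by fastforce

lemma best_approx_nonneg: "0 \<le> best_approx M p D n f"
  unfolding best_approx_def using zero_in_n_term by (intro cINF_greatest) auto

lemma best_approx_obtain:
  assumes "best_approx M p D n f < e"
  obtains g where "g \<in> n_term D n" "lp_norm M p (space M) (\<lambda>\<omega>. f \<omega> - g \<omega>) < e"
  using assms zero_in_n_term[of D n] unfolding best_approx_def
  by (subst (asm) cINF_less_iff[OF _ best_approx_bdd_below]) auto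

lemma best_approx_antimono:
  assumes "m \<le> n" shows "best_approx M p D n f \<le> best_approx M p D m f"
  unfolding best_approx_def using zero_in_n_term[of D m]
  by (intro cINF_superset_mono best_approx_bdd_below n_term_mono assms) auto

lemma best_approx_add:
  fixes f g :: "'a \<Rightarrow> 'k::{real_normed_field, euclidean_space}"
  assumes f: "f \<in> lp_space M p" and g: "g \<in> lp_space M p" and D: "D \<subseteq> lp_space M p" and p: "p \<ge> 1"
  shows "best_approx M p D (m + n) (\<lambda>\<omega>. f \<omega> + g \<omega>) \<le> best_approx M p D m f + best_approx M p D n g"
proof (rule field_le_epsilon)
  fix e :: real assume "e > 0"
  obtain u where u: "u \<in> n_term D m" "lp_norm M p (space M) (\<lambda>\<omega>. f \<omega> - u \<omega>) < best_approx M p D m f + e / 2"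
    using best_approx_obtain[of M p D m f "best_approx M p D m f + e / 2"] \<open>e > 0\<close> by auto
  obtain v where v: "v \<in> n_term D n" "lp_norm M p (space M) (\<lambda>\<omega>. g \<omega> - v \<omega>) < best_approx M p D n g + e / 2"
    using best_approx_obtain[of M p D n g "best_approx M p D n g + e / 2"] \<open>e > 0\<close> by auto
  have uv: "u \<in> lp_space M p" "v \<in> lp_space M p"
    using u v n_term_subset_span fun_span_subset_lp_space[OF D p] by blast+
  have "best_approx M p D (m + n) (\<lambda>\<omega>. f \<omega> + g \<omega>)
      \<le> lp_norm M p (space M) (\<lambda>\<omega>. (f \<omega> + g \<omega>) - (u \<omega> + v \<omega>))"
    by (rule best_approx_le[OF n_term_add[OF u(1) v(1)]])
  also have "\<dots> \<le> lp_norm M p (space M) (\<lambda>\<omega>. f \<omega> - u \<omega>) + lp_norm M p (space M) (\<lambda>\<omega>. g \<omega> - v \<omega>)"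
    using lp_norm_triangle[OF lp_space_diff[OF f uv(1) p] lp_space_diff[OF g uv(2) p] p]
    by (simp add: algebra_simps)
  finally show "best_approx M p D (m + n) (\<lambda>\<omega>. f \<omega> + g \<omega>) \<le> best_approx M p D m f + best_approx M p D n g + e"
    using u(2) v(2) by linarith
qed

text \<open>
  The numbers of terms add up together with the errors, so a telescoping sum can be approximated
  by spending a different number of terms on each of its summands.
\<close>

lemma best_approx_sum:
  fixes f :: "'i \<Rightarrow> 'a \<Rightarrow> 'k::{real_normed_field, euclidean_space}"
  assumes "finite I" "\<And>i. i \<in> I \<Longrightarrow> f i \<in> lp_space M p" and D: "D \<subseteq> lp_space M p" and p: "p \<ge> 1"
  shows "(\<lambda>\<omega>. \<Sum>i\<in>I. f i \<omega>) \<in> lp_space M p \<and>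
    best_approx M p D (\<Sum>i\<in>I. m i) (\<lambda>\<omega>. \<Sum>i\<in>I. f i \<omega>) \<le> (\<Sum>i\<in>I. best_approx M p D (m i) (f i))"
  using assms(1,2)
proof (induction I)
  case empty
  show ?case using best_approx_le_norm[of M p D 0 "\<lambda>_. 0"] by (simp add: lp_space_zero lp_norm_def)
next
  case (insert i I)
  then show ?case
    using best_approx_add[OF _ _ D p, of "f i" "\<lambda>\<omega>. \<Sum>i\<in>I. f i \<omega>" "m i" "\<Sum>i\<in>I. m i"]
    by (auto intro!: lp_space_add p)
qed

section \<open>Atoms and rings\<close>

context nary_filtration
begin

lemma sets_F_subset: "A \<in> sets (F n) \<Longrightarrow> A \<in> sets M"
  using subalg unfolding subalgebra_def by blast

lemma atom_in_sets: "A \<in> atoms_of (F n) \<Longrightarrow> A \<in> sets M"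
  unfolding atoms_of_def using sets_F_subset by blast

lemma all_atoms_in_sets: "A \<in> all_atoms F \<Longrightarrow> A \<in> sets M"
  unfolding all_atoms_def using atom_in_sets by blast

lemma ring_in_sets: "R \<in> all_atoms F \<union> rings_of F \<Longrightarrow> R \<in> sets M"
  unfolding rings_of_def using all_atoms_in_sets by auto

lemma finite_atoms: "finite (atoms_of (F n))"
  by (rule finite_subset[OF _ finite_sets[of n]]) (auto simp: atoms_of_def)

lemma atom_nonempty: "A \<in> all_atoms F \<Longrightarrow> A \<noteq> {}"
  unfolding all_atoms_def atoms_of_def by blast

text \<open>
  Atoms of all levels form a tree: two of them are disjoint or nested, since the coarser one
  belongs to the finer \<open>\<sigma>\<close>-algebra and cannot split an atom of it.
\<close>

lemma atom_meets_coarser: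
  assumes "A \<in> atoms_of (F m)" "B \<in> atoms_of (F n)" "m \<le> n" "A \<inter> B \<noteq> {}"
  shows "B \<subseteq> A"
proof -
  have "A \<in> sets (F n)" using assms(1) sets_F_mono[OF assms(3)] unfolding atoms_of_def by auto
  then have "A \<inter> B \<in> sets (F n)" using assms(2) unfolding atoms_of_def by auto
  then have "A \<inter> B = B" using assms(2,4) unfolding atoms_of_def by auto
  then show ?thesis by blast
qed

lemma atoms_nested:
  assumes "A \<in> all_atoms F" "B \<in> all_atoms F" "A \<inter> B \<noteq> {}"
  shows "A \<subseteq> B \<or> B \<subseteq> A"
proof -
  obtain m n where "A \<in> atoms_of (F m)" "B \<in> atoms_of (F n)" using assms unfolding all_atoms_def by blast
  then show ?thesis using atom_meets_coarser[of A m B n] atom_meets_coarser[of B n A m] assms(3)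
    by (cases "m \<le> n") auto
qed

lemma atoms_same_level_disjoint:
  assumes "A \<in> atoms_of (F n)" "B \<in> atoms_of (F n)" "A \<noteq> B"
  shows "A \<inter> B = {}"
  using atom_meets_coarser[of A n B n] atom_meets_coarser[of B n A n] assms by (auto simp: Int_commute)

lemma space_atom: "space M \<in> atoms_of (F 0)"
  unfolding atoms_of_def using not_empty sets_F_0 by auto

lemma Union_atoms: "\<Union>(atoms_of (F n)) = space M"
proof (induction n)
  case 0
  have "\<Union>(atoms_of (F 0)) \<subseteq> space M" using sets_F_0 unfolding atoms_of_def by blast
  then show ?case using space_atom by blast
next
  case (Suc n)
  have "A \<subseteq> \<Union>(atoms_of (F (Suc n)))" if "A \<in> atoms_of (F n)" for A
    using nary[OF that] by blast
  moreover have "\<Union>(atoms_of (F (Suc n))) \<subseteq> space M"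
    using atom_in_sets sets.sets_into_space by blast
  ultimately show ?case using Suc by blast
qed

end

section \<open>Functions that coincide locally with elements of the space\<close>

lemma restrict_fun_apply: "restrict_fun R f \<omega> = (if \<omega> \<in> R then f \<omega> else 0)"
  by (simp add: restrict_fun_def)

text \<open>
  Stated as a subspace property, so that \<open>fun_vs.span_minimal\<close> reduces questions about sums of
  dictionary elements to single dictionary elements.
\<close>

lemma subspace_coincide_on:
  fixes S :: "('a \<Rightarrow> 'k::{real_normed_field, euclidean_space}) set"
  assumes "fun_vs.subspace S"
  shows "fun_vs.subspace {f. \<exists>s\<in>S. \<forall>\<omega>\<in>R. f \<omega> = s \<omega>}"
  unfolding fun_vs.subspace_def
proof (intro conjI ballI allI)
  show "0 \<in> {f. \<exists>s\<in>S. \<forall>\<omega>\<in>R. f \<omega> = s \<omega>}"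
    using fun_vs.subspace_0[OF assms] by blast
next
  fix f g assume "f \<in> {f. \<exists>s\<in>S. \<forall>\<omega>\<in>R. f \<omega> = s \<omega>}" "g \<in> {f. \<exists>s\<in>S. \<forall>\<omega>\<in>R. f \<omega> = s \<omega>}"
  then obtain s t where "s \<in> S" "t \<in> S" "\<forall>\<omega>\<in>R. f \<omega> = s \<omega>" "\<forall>\<omega>\<in>R. g \<omega> = t \<omega>" by blast
  then show "f + g \<in> {f. \<exists>s\<in>S. \<forall>\<omega>\<in>R. f \<omega> = s \<omega>}"
    using fun_vs.subspace_add[OF assms, of s t] by (auto intro!: bexI[of _ "s + t"])
next
  fix f c assume "f \<in> {f. \<exists>s\<in>S. \<forall>\<omega>\<in>R. f \<omega> = s \<omega>}"
  then obtain s where "s \<in> S" "\<forall>\<omega>\<in>R. f \<omega> = s \<omega>" by blast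
  then show "(\<lambda>\<omega>. c * f \<omega>) \<in> {f. \<exists>s\<in>S. \<forall>\<omega>\<in>R. f \<omega> = s \<omega>}"
    using fun_vs.subspace_scale[OF assms, of s c] by (auto intro!: bexI[of _ "\<lambda>\<omega>. c * s \<omega>"])
qed

lemma subspace_S_level:
  fixes S :: "('a \<Rightarrow> 'k::{real_normed_field, euclidean_space}) set"
  assumes "fun_vs.subspace S"
  shows "fun_vs.subspace (S_level F S n)"
proof -
  have "S_level F S n = \<Inter>((\<lambda>A. {f. \<exists>s\<in>S. \<forall>\<omega>\<in>A. f \<omega> = s \<omega>}) ` atoms_of (F n))"
    unfolding S_level_def by auto
  then show ?thesis using subspace_coincide_on[OF assms] by (auto intro!: fun_vs.subspace_Inter)
qed

lemma local_error_bdd_below: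
  "bdd_below ((\<lambda>g. lp_norm M p R (\<lambda>\<omega>. f \<omega> - g \<omega>)) ` restrict_fun R ` S)"
  by (rule bdd_belowI[of _ 0]) auto

lemma local_error_le:
  assumes "s \<in> S"
  shows "local_error M S p f R \<le> lp_norm M p R (\<lambda>\<omega>. f \<omega> - restrict_fun R s \<omega>)"
  unfolding local_error_def by (rule cINF_lower[OF local_error_bdd_below]) (use assms in auto)

lemma local_error_nonneg:
  assumes "S \<noteq> {}" shows "0 \<le> local_error M S p f R"
  unfolding local_error_def using assms by (intro cINF_greatest) auto

lemma local_error_obtain:
  assumes "local_error M S p f R < e" "S \<noteq> {}"
  obtains s where "s \<in> S" "lp_norm M p R (\<lambda>\<omega>. f \<omega> - restrict_fun R s \<omega>) < e"
  using assms unfolding local_error_def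
  by (subst (asm) cINF_less_iff[OF _ local_error_bdd_below]) auto

lemma lp_norm_cong:
  assumes "\<And>\<omega>. \<omega> \<in> R \<Longrightarrow> norm (f \<omega>) = norm (g \<omega>)"
  shows "lp_norm M p R f = lp_norm M p R g"
  unfolding lp_norm_def set_lebesgue_integral_def
  by (intro arg_cong2[where f = "(powr)"] Bochner_Integration.integral_cong refl) (auto simp: assms indicator_def)

lemma local_error_le_lp_norm_diff:
  assumes "s \<in> S" "\<And>\<omega>. \<omega> \<in> R \<Longrightarrow> g \<omega> = s \<omega>"
  shows "local_error M S p f R \<le> lp_norm M p R (\<lambda>\<omega>. f \<omega> - g \<omega>)"
  using local_error_le[OF assms(1), of M p f R] lp_norm_cong[of R "\<lambda>\<omega>. f \<omega> - restrict_fun R s \<omega>" "\<lambda>\<omega>. f \<omega> - g \<omega>" M p]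
  by (simp add: restrict_fun_apply assms(2))

lemma local_error_eq_0:
  assumes "s \<in> S" "\<And>\<omega>. \<omega> \<in> R \<Longrightarrow> f \<omega> = s \<omega>"
  shows "local_error M S p f R = 0"
proof (rule antisym)
  have "local_error M S p f R \<le> lp_norm M p R (\<lambda>\<omega>. f \<omega> - f \<omega>)"
    by (rule local_error_le_lp_norm_diff[OF assms])
  then show "local_error M S p f R \<le> 0" by (simp add: lp_norm_def)
  show "0 \<le> local_error M S p f R" using assms(1) by (intro local_error_nonneg) auto
qed

lemma stable_space_subspace:
  fixes S :: "('a \<Rightarrow> 'k::{real_normed_field, euclidean_space}) set"
  assumes "stable_space M F S" shows "fun_vs.subspace S"
  using assms fun_vs.subspace_span unfolding stable_space_def by blast

context nary_filtration
begin

lemma local_dict_subset_lp_space: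
  fixes S :: "('a \<Rightarrow> 'k::{real_normed_field, euclidean_space}) set"
  assumes "stable_space M F S" "p \<ge> 0"
  shows "local_dict F S \<subseteq> lp_space M p"
proof
  fix g assume "g \<in> local_dict F S"
  then obtain A f where g: "g = restrict_fun A f" "A \<in> all_atoms F" "f \<in> S"
    unfolding local_dict_def by blast
  then obtain K where "f \<in> borel_measurable M" and K: "\<And>\<omega>. \<omega> \<in> space M \<Longrightarrow> norm (f \<omega>) \<le> K"
    using assms unfolding stable_space_def by blast
  moreover have "A \<in> sets M" using g all_atoms_in_sets by blast
  ultimately have "g \<in> borel_measurable M" unfolding g restrict_fun_def by measurable
  moreover have "norm (g \<omega>) \<le> K" if "\<omega> \<in> space M" for \<omega>
    using K[OF that] norm_ge_zero[of "f \<omega>"] unfolding g restrict_fun_apply by (auto simp del: norm_ge_zero)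
  ultimately show "g \<in> lp_space M p"
    using finite_measure_axioms assms(2) by (intro lp_space_bounded)
qed

text \<open>
  The definition of \<open>S_level\<close> mentions neither measurability nor integrability. Both hold because
  such a function coincides on the whole space with a finite sum of elements of the dictionary.
\<close>

lemma S_level_subset_lp_space:
  fixes S :: "('a \<Rightarrow> 'k::{real_normed_field, euclidean_space}) set"
  assumes "stable_space M F S" "p \<ge> 1"
  shows "S_level F S n \<subseteq> lp_space M p"
proof
  fix u assume "u \<in> S_level F S n"
  then obtain g where g: "\<And>A. A \<in> atoms_of (F n) \<Longrightarrow> g A \<in> S" "\<And>A \<omega>. A \<in> atoms_of (F n) \<Longrightarrow> \<omega> \<in> A \<Longrightarrow> u \<omega> = g A \<omega>"
    unfolding S_level_def mem_Collect_eq by metis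
  define v where "v = (\<Sum>A\<in>atoms_of (F n). restrict_fun A (g A))"
  have "v \<in> fun_span (local_dict F S)" unfolding v_def
    by (intro fun_vs.span_sum fun_vs.span_base) (auto simp: local_dict_def all_atoms_def intro: g(1))
  then have v: "v \<in> lp_space M p"
    using fun_span_subset_lp_space[OF local_dict_subset_lp_space[OF assms(1)] assms(2), of] assms(2) by auto
  have eq: "u \<omega> = v \<omega>" if "\<omega> \<in> space M" for \<omega>
  proof -
    from that have "\<omega> \<in> \<Union>(atoms_of (F n))" by (simp only: Union_atoms)
    then obtain A where A: "A \<in> atoms_of (F n)" "\<omega> \<in> A" by (elim UnionE)
    have "v \<omega> = (\<Sum>B\<in>atoms_of (F n). restrict_fun B (g B) \<omega>)"
      unfolding v_def by (induction rule: infinite_finite_induct) auto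
    also have "\<dots> = (\<Sum>B\<in>atoms_of (F n). if B = A then g A \<omega> else 0)"
      using A atoms_same_level_disjoint[of A n] by (intro sum.cong) (auto simp: restrict_fun_apply)
    also have "\<dots> = u \<omega>" using A g(2) by (simp add: finite_atoms)
    finally show ?thesis by simp
  qed
  have "u \<in> borel_measurable M" using lp_spaceD(1)[OF v] measurable_cong[of M u v borel] eq by simp
  moreover have "integrable M (\<lambda>\<omega>. norm (u \<omega>) powr p)"
    using lp_spaceD(2)[OF v] by (subst Bochner_Integration.integrable_cong[OF refl, of M _ "\<lambda>\<omega>. norm (v \<omega>) powr p"]) (auto simp: eq)
  ultimately show "u \<in> lp_space M p" by (simp add: lp_space_def)
qed

lemma local_orthonormal_system_subset_lp_space:
  fixes S :: "('a \<Rightarrow> 'k::{real_normed_field, euclidean_space}) set"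
  assumes S: "stable_space M F S" and "local_orthonormal_system M F S \<Phi>" and p: "p \<ge> 1"
  shows "(\<Union>n. \<Phi> n) \<subseteq> lp_space M p"
proof safe
  fix \<phi> n assume "\<phi> \<in> \<Phi> n"
  then have "\<phi> \<in> proj_diff_range M F S n"
    using assms unfolding local_orthonormal_system_def orthonormal_basis_def by blast
  then obtain u v where uv: "\<phi> = (\<lambda>\<omega>. u \<omega> - v \<omega>)" "u \<in> S_level F S n"
      "v \<in> (if n = 0 then {0} else S_level F S (n - 1))"
    unfolding proj_diff_range_def is_orth_proj_def by blast
  then have "v \<in> lp_space M p"
    using S_level_subset_lp_space[OF S p] lp_space_zero[of M p] by (auto simp: zero_fun_def split: if_splits)
  then show "\<phi> \<in> lp_space M p" unfolding uv
    using uv S_level_subset_lp_space[OF S p] by (intro lp_space_diff p) auto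
qed

lemma span_local_dict_eventually_S_level:
  fixes S :: "('a \<Rightarrow> 'k::{real_normed_field, euclidean_space}) set"
  assumes S: "fun_vs.subspace S" and g: "g \<in> fun_span (local_dict F S)"
  shows "\<exists>N. \<forall>n\<ge>N. g \<in> S_level F S n"
proof -
  let ?V = "{g. \<exists>N. \<forall>n\<ge>N. g \<in> S_level F S n}"
  have "fun_vs.subspace ?V"
    unfolding fun_vs.subspace_def
  proof (intro conjI ballI allI)
    show "0 \<in> ?V" using fun_vs.subspace_0[OF subspace_S_level[OF S]] by auto
  next
    fix f g assume "f \<in> ?V" "g \<in> ?V"
    then obtain N N' where "\<forall>n\<ge>N. f \<in> S_level F S n" "\<forall>n\<ge>N'. g \<in> S_level F S n" by blast
    then have "\<forall>n\<ge>max N N'. f + g \<in> S_level F S n"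
      using fun_vs.subspace_add[OF subspace_S_level[OF S]] by auto
    then show "f + g \<in> ?V" by blast
  next
    fix f c assume "f \<in> ?V"
    then show "(\<lambda>\<omega>. c * f \<omega>) \<in> ?V"
      using fun_vs.subspace_scale[OF subspace_S_level[OF S]] by blast
  qed
  moreover have "local_dict F S \<subseteq> ?V"
  proof
    fix g assume "g \<in> local_dict F S"
    then obtain A f N where g: "g = restrict_fun A f" "A \<in> atoms_of (F N)" "f \<in> S"
      unfolding local_dict_def all_atoms_def by blast
    have "g \<in> S_level F S n" if "n \<ge> N" for n
      unfolding S_level_def
    proof (intro CollectI ballI)
      fix B assume B: "B \<in> atoms_of (F n)"
      show "\<exists>s\<in>S. \<forall>\<omega>\<in>B. g \<omega> = s \<omega>"
      proof (cases "A \<inter> B = {}")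
        case True
        then have "\<forall>\<omega>\<in>B. g \<omega> = 0 \<omega>" by (auto simp: g restrict_fun_apply)
        then show ?thesis using fun_vs.subspace_0[OF S] by blast
      next
        case False
        then have "B \<subseteq> A" using atom_meets_coarser[OF g(2) B that] by blast
        then show ?thesis using g(3) by (intro bexI[of _ f]) (auto simp: g restrict_fun_apply)
      qed
    qed
    then show "g \<in> ?V" by blast
  qed
  ultimately have "fun_span (local_dict F S) \<subseteq> ?V" by (intro fun_vs.span_minimal)
  then show ?thesis using g by blast
qed

text \<open>
  Atoms need not shrink to null sets, so this does not follow from the integrability of \<open>f\<close>. It
  holds because \<open>f\<close> is close to a finite sum of dictionary elements, which coincides with an
  element of \<open>S\<close> on each atom of a sufficiently deep level.
\<close>

lemma local_error_small_at_deep_level: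
  fixes S :: "('a \<Rightarrow> 'k::{real_normed_field, euclidean_space}) set"
  assumes S: "stable_space M F S" and f: "f \<in> lp_S M F S p" and p: "p \<ge> 1" and "\<epsilon> > 0"
  shows "\<exists>N. \<forall>A\<in>atoms_of (F N). local_error M S p f A < \<epsilon>"
proof -
  have fp: "f \<in> lp_space M p" using f unfolding lp_S_def by blast
  obtain g where g: "g \<in> fun_span (local_dict F S)" "lp_norm M p (space M) (\<lambda>\<omega>. f \<omega> - g \<omega>) < \<epsilon>"
    using f \<open>\<epsilon> > 0\<close> unfolding lp_S_def by blast
  have gp: "g \<in> lp_space M p"
    using g(1) fun_span_subset_lp_space[OF local_dict_subset_lp_space[OF S] p] p by auto
  obtain N where N: "g \<in> S_level F S N"
    using span_local_dict_eventually_S_level[OF stable_space_subspace[OF S] g(1)] by blast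
  have "local_error M S p f A < \<epsilon>" if A: "A \<in> atoms_of (F N)" for A
  proof -
    obtain s where s: "s \<in> S" "\<And>\<omega>. \<omega> \<in> A \<Longrightarrow> g \<omega> = s \<omega>" using N A unfolding S_level_def by blast
    have "local_error M S p f A \<le> lp_norm M p A (\<lambda>\<omega>. f \<omega> - g \<omega>)"
      by (rule local_error_le_lp_norm_diff[OF s])
    also have "\<dots> \<le> lp_norm M p (space M) (\<lambda>\<omega>. f \<omega> - g \<omega>)"
      using atom_in_sets[OF A] sets.sets_into_space p
      by (intro lp_norm_subset lp_space_diff fp gp) auto
    finally show ?thesis using g(2) by simp
  qed
  then show ?thesis by blast
qed

end

section \<open>A direct estimate for the variation spaces\<close>

text \<open>
  A localization to a ring is the difference of localizations to two atoms. This is where the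
  factor \<open>2\<close> between the number of pieces of a partition and the number of dictionary elements
  comes from.
\<close>

lemma (in nary_filtration) restrict_ring_n_term:
  assumes "fun_vs.subspace S" "s \<in> S" "R \<in> all_atoms F \<union> rings_of F"
  shows "restrict_fun R s \<in> n_term (local_dict F S) 2"
proof -
  have atom: "restrict_fun A s \<in> n_term (local_dict F S) 1" if "A \<in> all_atoms F" for A
    using that assms(2) by (intro n_term_base) (auto simp: local_dict_def)
  show ?thesis
  proof (cases "R \<in> all_atoms F")
    case True
    then show ?thesis using atom n_term_mono[of 1 2 "local_dict F S"] by auto
  next
    case False
    then obtain A B where AB: "R = A - B" "A \<in> all_atoms F" "B \<in> all_atoms F" "B \<subset> A"
      using assms(3) unfolding rings_of_def by blast
    have "restrict_fun R s = (\<lambda>\<omega>. restrict_fun A s \<omega> - restrict_fun B s \<omega>)"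
      using AB by (auto simp: restrict_fun_apply fun_eq_iff)
    then show ?thesis using n_term_diff[OF atom[OF AB(2)] atom[OF AB(3)]]
      by (simp only: one_add_one)
  qed
qed

text \<open>
  What a partition of \<open>R\<close> into \<open>m\<close> atoms and rings with local errors below \<open>\<epsilon>\<close> is good for. Only
  the approximant that is glued from such pieces is recorded, not the partition itself, because
  then disjoint unions simply add the counts.
\<close>

definition approx_by_pieces ::
  "'a measure \<Rightarrow> (nat \<Rightarrow> 'a measure) \<Rightarrow> ('a \<Rightarrow> 'k::{real_normed_field, euclidean_space}) set \<Rightarrow> real \<Rightarrow> real
    \<Rightarrow> ('a \<Rightarrow> 'k) \<Rightarrow> 'a set \<Rightarrow> nat \<Rightarrow> bool" where
  "approx_by_pieces M F S p \<epsilon> f R m \<longleftrightarrow>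
     (\<exists>g\<in>n_term (local_dict F S) (2 * m). (\<forall>\<omega>. \<omega> \<notin> R \<longrightarrow> g \<omega> = 0) \<and>
        (LINT \<omega>:R|M. norm (f \<omega> - g \<omega>) powr p) \<le> real m * \<epsilon> powr p)"

definition large_error_packing ::
  "'a measure \<Rightarrow> (nat \<Rightarrow> 'a measure) \<Rightarrow> ('a \<Rightarrow> 'k::{real_normed_field, euclidean_space}) set \<Rightarrow> real \<Rightarrow> real
    \<Rightarrow> ('a \<Rightarrow> 'k) \<Rightarrow> 'a set \<Rightarrow> 'a set set \<Rightarrow> bool" where
  "large_error_packing M F S p \<epsilon> f B Q \<longleftrightarrow> finite Q \<and> Q \<subseteq> all_atoms F \<union> rings_of F \<and> disjoint Q \<and>
     (\<forall>R\<in>Q. R \<subseteq> B \<and> \<epsilon> \<le> local_error M S p f R)"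

context nary_filtration
begin

text \<open>
  The state of the recursion at an atom \<open>A\<close> with large local error: \<open>A\<close> is a core \<open>B\<close> and a ring
  \<open>A - B\<close> of small error. The core is partitioned into \<open>m\<close> pieces of small error, and their
  number is paid for by disjoint sets of large error inside \<open>B\<close>. The ring is kept open, so that it
  can grow outwards along a chain of atoms without creating a piece at every step. The \<open>\<nu>\<close> saved
  in \<open>m + \<nu> \<le> 2 * \<nu> * card Q\<close> pays for the pieces that arise where several such chains meet.
\<close>

definition core_of_atom ::
  "('a \<Rightarrow> 'k::{real_normed_field, euclidean_space}) set \<Rightarrow> real \<Rightarrow> real \<Rightarrow> ('a \<Rightarrow> 'k)
    \<Rightarrow> 'a set \<Rightarrow> 'a set \<Rightarrow> nat \<Rightarrow> 'a set set \<Rightarrow> bool" where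
  "core_of_atom S p \<epsilon> f A B m Q \<longleftrightarrow> B \<in> all_atoms F \<and> B \<subseteq> A \<and> local_error M S p f (A - B) < \<epsilon> \<and>
     approx_by_pieces M F S p \<epsilon> f B m \<and> large_error_packing M F S p \<epsilon> f B Q \<and> m + \<nu> \<le> 2 * \<nu> * card Q"

context
  fixes S :: "('a \<Rightarrow> 'k::{real_normed_field, euclidean_space}) set" and p \<epsilon> :: real and f :: "'a \<Rightarrow> 'k"
  assumes S: "stable_space M F S" and f: "f \<in> lp_space M p" and p: "p \<ge> 1" and \<epsilon>: "\<epsilon> > 0"
begin

abbreviation "pieces \<equiv> approx_by_pieces M F S p \<epsilon> f"
abbreviation "err \<equiv> local_error M S p f"
abbreviation "bad_packing \<equiv> large_error_packing M F S p \<epsilon> f"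
abbreviation "core \<equiv> core_of_atom S p \<epsilon> f"

lemma S_subspace: "fun_vs.subspace S"
  using S by (rule stable_space_subspace)

lemma S_nonempty: "S \<noteq> {}"
  using fun_vs.subspace_0[OF S_subspace] by blast

lemma n_term_local_lp: "g \<in> n_term (local_dict F S) n \<Longrightarrow> g \<in> lp_space M p"
  using n_term_subset_span fun_span_subset_lp_space[OF local_dict_subset_lp_space[OF S] p] p by fastforce

lemma err_empty: "err {} = 0"
proof -
  obtain s where "s \<in> S" using S_nonempty by blast
  then show ?thesis by (rule local_error_eq_0) auto
qed

lemma pieces_empty: "pieces {} 0"
  unfolding approx_by_pieces_def using zero_in_n_term[of "local_dict F S" "2 * 0"]
  by (intro bexI[of _ "\<lambda>_. 0"]) (auto simp: set_lebesgue_integral_def)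

lemma pieces_single:
  assumes R: "R = {} \<or> R \<in> all_atoms F \<union> rings_of F" and "err R < \<epsilon>"
  shows "pieces R 1"
proof -
  obtain s where s: "s \<in> S" "lp_norm M p R (\<lambda>\<omega>. f \<omega> - restrict_fun R s \<omega>) < \<epsilon>"
    using local_error_obtain[OF assms(2) S_nonempty] by blast
  have "restrict_fun R s \<in> n_term (local_dict F S) (2 * 1)"
    using R
  proof
    assume "R = {}"
    then have "restrict_fun R s = (\<lambda>_. 0)" by (auto simp: restrict_fun_apply fun_eq_iff)
    then show ?thesis by (simp add: zero_in_n_term)
  qed (use restrict_ring_n_term[OF S_subspace s(1)] in auto)
  moreover have "(LINT \<omega>:R|M. norm (f \<omega> - restrict_fun R s \<omega>) powr p) \<le> \<epsilon> powr p"
    using s(2) p \<epsilon> lp_norm_le_iff[of p \<epsilon> M R "\<lambda>\<omega>. f \<omega> - restrict_fun R s \<omega>"] by simp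
  ultimately show ?thesis unfolding approx_by_pieces_def
    by (intro bexI[of _ "restrict_fun R s"]) (auto simp: restrict_fun_apply)
qed

lemma pieces_Un:
  assumes "pieces A m" "pieces B n" "A \<in> sets M" "B \<in> sets M" "A \<inter> B = {}"
  shows "pieces (A \<union> B) (m + n)"
proof -
  obtain g h where
    g: "g \<in> n_term (local_dict F S) (2 * m)" "\<And>\<omega>. \<omega> \<notin> A \<Longrightarrow> g \<omega> = 0"
       "(LINT \<omega>:A|M. norm (f \<omega> - g \<omega>) powr p) \<le> real m * \<epsilon> powr p" and
    h: "h \<in> n_term (local_dict F S) (2 * n)" "\<And>\<omega>. \<omega> \<notin> B \<Longrightarrow> h \<omega> = 0"
       "(LINT \<omega>:B|M. norm (f \<omega> - h \<omega>) powr p) \<le> real n * \<epsilon> powr p"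
    using assms(1,2) unfolding approx_by_pieces_def by blast
  define k where "k = (\<lambda>\<omega>. g \<omega> + h \<omega>)"
  have k: "k \<in> n_term (local_dict F S) (2 * (m + n))"
    using n_term_add[OF g(1) h(1)] by (simp add: k_def algebra_simps)
  have kA: "k \<omega> = g \<omega>" if "\<omega> \<in> A" for \<omega> using that assms(5) h(2)[of \<omega>] by (auto simp: k_def)
  have kB: "k \<omega> = h \<omega>" if "\<omega> \<in> B" for \<omega> using that assms(5) g(2)[of \<omega>] by (auto simp: k_def)
  have fk: "(\<lambda>\<omega>. f \<omega> - k \<omega>) \<in> lp_space M p"
    by (rule lp_space_diff[OF f n_term_local_lp[OF k] p])
  have "(LINT \<omega>:A \<union> B|M. norm (f \<omega> - k \<omega>) powr p)
      = (LINT \<omega>:A|M. norm (f \<omega> - k \<omega>) powr p) + (LINT \<omega>:B|M. norm (f \<omega> - k \<omega>) powr p)"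
    by (rule set_integral_Un[OF assms(5) set_integrable_lp[OF fk assms(3)] set_integrable_lp[OF fk assms(4)]])
  also have "(LINT \<omega>:A|M. norm (f \<omega> - k \<omega>) powr p) = (LINT \<omega>:A|M. norm (f \<omega> - g \<omega>) powr p)"
    by (rule set_lebesgue_integral_cong[OF assms(3)]) (auto simp: kA)
  also have "(LINT \<omega>:B|M. norm (f \<omega> - k \<omega>) powr p) = (LINT \<omega>:B|M. norm (f \<omega> - h \<omega>) powr p)"
    by (rule set_lebesgue_integral_cong[OF assms(4)]) (auto simp: kB)
  finally have "(LINT \<omega>:A \<union> B|M. norm (f \<omega> - k \<omega>) powr p) \<le> real (m + n) * \<epsilon> powr p"
    using g(3) h(3) by (simp add: algebra_simps)
  moreover have "\<forall>\<omega>. \<omega> \<notin> A \<union> B \<longrightarrow> k \<omega> = 0" using g(2) h(2) by (simp add: k_def)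
  ultimately show ?thesis unfolding approx_by_pieces_def using k by blast
qed

lemma pieces_Union:
  assumes "finite \<U>" "\<And>U. U \<in> \<U> \<Longrightarrow> U \<in> sets M" "\<And>U. U \<in> \<U> \<Longrightarrow> pieces U (m U)"
    "\<And>U V. U \<in> \<U> \<Longrightarrow> V \<in> \<U> \<Longrightarrow> U \<noteq> V \<Longrightarrow> U \<inter> V = {}"
  shows "pieces (\<Union>\<U>) (\<Sum>U\<in>\<U>. m U)"
  using assms
proof (induction \<U>)
  case empty
  show ?case using pieces_empty by simp
next
  case (insert U \<U>)
  have "pieces (\<Union>\<U>) (\<Sum>U\<in>\<U>. m U)"
    using insert.prems insert.IH by simp
  moreover have "U \<inter> \<Union>\<U> = {}" using insert.prems(3)[of U] insert.hyps by auto
  moreover have "\<Union>\<U> \<in> sets M" using insert by (intro sets.finite_Union) auto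
  ultimately show ?case
    using pieces_Un[of U "m U" "\<Union>\<U>" "\<Sum>U\<in>\<U>. m U"] insert by simp
qed

lemma bad_nonempty: "\<epsilon> \<le> err R \<Longrightarrow> R \<noteq> {}"
  using err_empty \<epsilon> by auto

lemma diff_atoms_cases:
  assumes "A \<in> all_atoms F" "B \<in> all_atoms F" "B \<subseteq> A"
  shows "A - B = {} \<or> A - B \<in> all_atoms F \<union> rings_of F"
  using assms unfolding rings_of_def by blast

lemma pieces_of_core:
  assumes "core A B m Q" "A \<in> all_atoms F"
  shows "pieces A (m + 1)"
proof -
  have B: "B \<in> all_atoms F" "B \<subseteq> A" "err (A - B) < \<epsilon>" "pieces B m"
    using assms(1) unfolding core_of_atom_def by auto
  have "pieces (A - B) 1"
    using diff_atoms_cases[OF assms(2) B(1,2)] B(3) by (rule pieces_single)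
  moreover have "B \<union> (A - B) = A" using B(2) by blast
  ultimately show ?thesis
    using pieces_Un[OF B(4), of "A - B" 1] all_atoms_in_sets[OF assms(2)] all_atoms_in_sets[OF B(1)] by auto
qed

lemma bad_packing_Union:
  assumes "finite \<U>" "\<And>C. C \<in> \<U> \<Longrightarrow> bad_packing (B C) (Q C)"
    "\<And>C. C \<in> \<U> \<Longrightarrow> B C \<subseteq> C" "\<And>C D. C \<in> \<U> \<Longrightarrow> D \<in> \<U> \<Longrightarrow> C \<noteq> D \<Longrightarrow> C \<inter> D = {}"
  shows "bad_packing (\<Union>C\<in>\<U>. B C) (\<Union>C\<in>\<U>. Q C)" "card (\<Union>C\<in>\<U>. Q C) = (\<Sum>C\<in>\<U>. card (Q C))"
proof -
  have sub: "R \<subseteq> C" "R \<noteq> {}" if "C \<in> \<U>" "R \<in> Q C" for R C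
    using assms(2,3)[OF that(1)] that(2) bad_nonempty unfolding large_error_packing_def by blast+
  have dis: "R = R' \<or> R \<inter> R' = {}" if "C \<in> \<U>" "R \<in> Q C" "D \<in> \<U>" "R' \<in> Q D" for R R' C D
  proof (cases "C = D")
    case True
    have "disjoint (Q C)" using assms(2)[OF that(1)] unfolding large_error_packing_def by blast
    then show ?thesis using that True unfolding disjoint_def by blast
  next
    case False
    then show ?thesis using sub(1)[OF that(1,2)] sub(1)[OF that(3,4)] assms(4)[OF that(1,3)] by blast
  qed
  show "bad_packing (\<Union>C\<in>\<U>. B C) (\<Union>C\<in>\<U>. Q C)"
    unfolding large_error_packing_def
  proof (intro conjI)
    show "finite (\<Union>C\<in>\<U>. Q C)" using assms(1,2) unfolding large_error_packing_def by blast
    show "(\<Union>C\<in>\<U>. Q C) \<subseteq> all_atoms F \<union> rings_of F" using assms(2) unfolding large_error_packing_def by blast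
    show "disjoint (\<Union>C\<in>\<U>. Q C)" unfolding disjoint_def using dis by blast
    show "\<forall>R\<in>(\<Union>C\<in>\<U>. Q C). R \<subseteq> (\<Union>C\<in>\<U>. B C) \<and> \<epsilon> \<le> err R"
      using assms(2) unfolding large_error_packing_def by blast
  qed
  show "card (\<Union>C\<in>\<U>. Q C) = (\<Sum>C\<in>\<U>. card (Q C))"
  proof (rule card_UN_disjoint[OF assms(1)])
    show "\<forall>i\<in>\<U>. finite (Q i)" using assms(2) unfolding large_error_packing_def by blast
    show "\<forall>i\<in>\<U>. \<forall>j\<in>\<U>. i \<noteq> j \<longrightarrow> Q i \<inter> Q j = {}"
    proof (intro ballI impI)
      fix C D assume CD: "C \<in> \<U>" "D \<in> \<U>" "C \<noteq> D"
      have False if "R \<in> Q C" "R \<in> Q D" for R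
        using sub(1)[OF CD(1) that(1)] sub(1)[OF CD(2) that(2)] sub(2)[OF CD(1) that(1)] assms(4)[OF CD] by auto
      then show "Q C \<inter> Q D = {}" by auto
    qed
  qed
qed

lemma bad_packing_mono: "bad_packing B Q \<Longrightarrow> B \<subseteq> A \<Longrightarrow> bad_packing A Q"
  unfolding large_error_packing_def by blast

lemma bad_packing_insert:
  assumes "bad_packing B Q" "B \<subseteq> A" "R \<in> all_atoms F \<union> rings_of F" "R \<subseteq> A" "R \<inter> B = {}" "\<epsilon> \<le> err R"
  shows "bad_packing A (insert R Q)" "card (insert R Q) = card Q + 1"
proof -
  have Q: "finite Q" "Q \<subseteq> all_atoms F \<union> rings_of F" "disjoint Q" "\<And>R. R \<in> Q \<Longrightarrow> R \<subseteq> B \<and> \<epsilon> \<le> err R"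
    using assms(1) unfolding large_error_packing_def by auto
  have meet: "R \<inter> R' = {}" "R' \<inter> R = {}" if "R' \<in> Q" for R' using Q(4)[OF that] assms(5) by auto
  then have "R \<notin> Q" using bad_nonempty[OF assms(6)] by auto
  then show "card (insert R Q) = card Q + 1" using Q(1) by simp
  show "bad_packing A (insert R Q)"
    unfolding large_error_packing_def
  proof (intro conjI)
    show "finite (insert R Q)" using Q by simp
    show "insert R Q \<subseteq> all_atoms F \<union> rings_of F" using Q(2) assms(3) by simp
    show "disjoint (insert R Q)" using Q(3) meet unfolding disjoint_def by simp
    show "\<forall>R'\<in>insert R Q. R' \<subseteq> A \<and> \<epsilon> \<le> err R'"
    proof
      fix R' assume "R' \<in> insert R Q"
      then show "R' \<subseteq> A \<and> \<epsilon> \<le> err R'"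
        using Q(4)[of R'] assms(2,4,6) by auto
    qed
  qed
qed

lemma bad_packing_empty: "bad_packing B {}"
  by (simp add: large_error_packing_def)

text \<open>
  By recursion from the deep levels, where all errors are small, to the coarse ones. Let \<open>A\<close> have
  large error. If no child of \<open>A\<close> has large error, the children are the pieces and \<open>A\<close> itself is a
  set of large error. If exactly one child has, its core remains the core of \<open>A\<close> as long as the ring
  around it has small error; otherwise this ring joins the packing, which pays for at most \<open>\<nu>\<close> new
  pieces. If at least two children have, their packings are disjoint, and each of them has \<open>\<nu>\<close> to
  spare while at most \<open>\<nu>\<close> new pieces arise.
\<close>

lemma core_exists:
  assumes small: "\<And>A. A \<in> atoms_of (F N) \<Longrightarrow> err A < \<epsilon>"
    and "n \<le> N" "A \<in> atoms_of (F n)"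
  shows "err A < \<epsilon> \<or> (\<exists>B m Q. core A B m Q)"
  using assms(2,3)
proof (induction n arbitrary: A rule: inc_induct)
  case base
  then show ?case using small by blast
next
  case (step n)
  have A: "A \<in> all_atoms F" using step.prems unfolding all_atoms_def by blast
  show ?case
  proof (cases "err A < \<epsilon>")
    case False
    then have bad: "\<epsilon> \<le> err A" by simp
    obtain \<U> where \<U>: "\<U> \<subseteq> atoms_of (F (Suc n))" "finite \<U>" "card \<U> \<le> \<nu>" and A_eq: "A = \<Union>\<U>"
      using nary[OF step.prems] by blast
    have atom: "C \<in> all_atoms F" "C \<in> sets M" if "C \<in> \<U>" for C
      using that \<U>(1) all_atoms_in_sets unfolding all_atoms_def by blast+
    have disj: "C \<inter> D = {}" if "C \<in> \<U>" "D \<in> \<U>" "C \<noteq> D" for C D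
      using that \<U>(1) atoms_same_level_disjoint by blast
    define X where "X = {C\<in>\<U>. \<epsilon> \<le> err C}"
    have X: "finite X" "X \<subseteq> \<U>" using \<U>(2) by (auto simp: X_def)
    have "\<exists>B m Q. core C B m Q" if "C \<in> X" for C
      using step.IH[of C] that \<U>(1) unfolding X_def by fastforce
    then obtain B m Q where core: "\<And>C. C \<in> X \<Longrightarrow> core C (B C) (m C) (Q C)" by metis
    \<comment> \<open>The number of pieces of a child when the ring around its core is closed and counted.\<close>
    define k where "k C = (if C \<in> X then m C + 1 else 1)" for C
    have "pieces C (k C)" if "C \<in> \<U>" for C
      using that pieces_of_core[OF core atom(1)] pieces_single[of C] atom(1)[OF that] by (auto simp: k_def X_def)
    then have pA: "pieces A (\<Sum>C\<in>\<U>. k C)"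
      unfolding A_eq using \<U>(2) atom disj by (intro pieces_Union) auto
    have "(\<Sum>C\<in>\<U>. k C) = (\<Sum>C\<in>\<U>. (if C \<in> X then m C else 0) + 1)"
      by (intro sum.cong) (auto simp: k_def)
    also have "\<dots> = (\<Sum>C\<in>X. m C) + card \<U>"
      unfolding sum.distrib sum.inter_filter[OF \<U>(2), symmetric]
      using X(2) by (simp add: Collect_conj_eq Int_absorb1)
    finally have k_le: "(\<Sum>C\<in>\<U>. k C) \<le> (\<Sum>C\<in>X. m C) + \<nu>" using \<U>(3) by simp
    let ?Q = "\<Union>C\<in>X. Q C"
    have Bsub: "B C \<subseteq> C" "bad_packing (B C) (Q C)" "m C + \<nu> \<le> 2 * \<nu> * card (Q C)" if "C \<in> X" for C
      using core[OF that] unfolding core_of_atom_def by auto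
    have pack: "bad_packing (\<Union>C\<in>X. B C) ?Q" "card ?Q = (\<Sum>C\<in>X. card (Q C))"
      using bad_packing_Union[OF X(1), of B Q] Bsub(1,2) disj[OF subsetD[OF X(2)] subsetD[OF X(2)]] by blast+
    have UB: "(\<Union>C\<in>X. B C) \<subseteq> A" using Bsub(1) X(2) A_eq by blast
    have sum_le: "(\<Sum>C\<in>X. m C) + card X * \<nu> \<le> 2 * \<nu> * card ?Q"
      using sum_mono[of X "\<lambda>C. m C + \<nu>" "\<lambda>C. 2 * \<nu> * card (Q C)"] Bsub(3)
      by (simp add: sum.distrib sum_distrib_left pack(2))
    have coreA: "core A A (\<Sum>C\<in>\<U>. k C) Q'" if "bad_packing A Q'" "(\<Sum>C\<in>X. m C) + 2 * \<nu> \<le> 2 * \<nu> * card Q'" for Q'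
      unfolding core_of_atom_def using A pA err_empty \<epsilon> that k_le by auto
    consider "card X = 0" | "card X = 1" | "card X \<ge> 2" by linarith
    then have "\<exists>B m Q. core A B m Q"
    proof cases
      case 1
      then have "X = {}" using X by simp
      have "core A A (\<Sum>C\<in>\<U>. k C) {A}"
        using bad_packing_insert[OF bad_packing_empty[of "{}"], of A A] A bad \<open>X = {}\<close> by (intro coreA) auto
      then show ?thesis by blast
    next
      case 2
      then obtain C where C: "X = {C}" by (auto simp: card_1_singleton_iff)
      have coreC: "core C (B C) (m C) (Q C)" using core C by blast
      have BC: "B C \<in> all_atoms F" "B C \<subseteq> A" using coreC UB unfolding core_of_atom_def C by auto
      show ?thesis
      proof (cases "err (A - B C) < \<epsilon>")
        case True
        then have "core A (B C) (m C) (Q C)" using coreC BC unfolding core_of_atom_def by auto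
        then show ?thesis by blast
      next
        case False
        then have R: "\<epsilon> \<le> err (A - B C)" by simp
        then have "A - B C \<in> all_atoms F \<union> rings_of F"
          using diff_atoms_cases[OF A BC] bad_nonempty by blast
        then have "bad_packing A (insert (A - B C) (Q C))" "card (insert (A - B C) (Q C)) = card (Q C) + 1"
          using bad_packing_insert[OF Bsub(2) BC(2)] R C by auto
        then have "core A A (\<Sum>C\<in>\<U>. k C) (insert (A - B C) (Q C))"
          using Bsub(3)[of C] C by (intro coreA) (auto simp: algebra_simps)
        then show ?thesis by blast
      qed
    next
      case 3
      then have "2 * \<nu> \<le> card X * \<nu>" by simp
      with sum_le have "(\<Sum>C\<in>X. m C) + 2 * \<nu> \<le> 2 * \<nu> * card ?Q" by linarith
      with bad_packing_mono[OF pack(1) UB] have "core A A (\<Sum>C\<in>\<U>. k C) ?Q" by (rule coreA)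
      then show ?thesis by blast
    qed
    then show ?thesis ..
  qed simp
qed

text \<open>
  In the end the ring around the core of the whole space becomes a piece, too.
\<close>

lemma pieces_space:
  assumes "\<exists>N. \<forall>A\<in>atoms_of (F N). err A < \<epsilon>"
  shows "\<exists>m. pieces (space M) m \<and> (m \<le> 1 \<or> (\<exists>Q. bad_packing (space M) Q \<and> m \<le> 2 * \<nu> * card Q))"
proof -
  have \<Omega>: "space M \<in> all_atoms F" using space_atom unfolding all_atoms_def by blast
  obtain N where "\<forall>A\<in>atoms_of (F N). err A < \<epsilon>" using assms by blast
  then consider "err (space M) < \<epsilon>" | B m Q where "core (space M) B m Q"
    using core_exists[of N 0] space_atom by blast
  then show ?thesis
  proof cases
    case 1
    then have "pieces (space M) 1" using \<Omega> by (intro pieces_single) auto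
    then show ?thesis by blast
  next
    case 2
    have "bad_packing (space M) Q" "m + \<nu> \<le> 2 * \<nu> * card Q"
      using 2 bad_packing_mono unfolding core_of_atom_def by blast+
    then show ?thesis using pieces_of_core[OF 2 \<Omega>] nu_ge_2 by (intro exI[of _ "m + 1"]) auto
  qed
qed

lemma card_bad_packing:
  assumes "bad_packing B Q" "\<sigma> > 0" "var_seminorm M F S \<sigma> p f \<le> ennreal v" "v \<ge> 0"
  shows "real (card Q) * \<epsilon> powr \<sigma> \<le> v powr \<sigma>"
proof -
  let ?s = "\<Sum>R\<in>Q. err R powr \<sigma>"
  have Q: "finite Q" "Q \<subseteq> all_atoms F \<union> rings_of F" "disjoint Q" "\<And>R. R \<in> Q \<Longrightarrow> \<epsilon> \<le> err R"
    using assms(1) unfolding large_error_packing_def by auto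
  have "ennreal (?s powr (1 / \<sigma>)) \<le> var_seminorm M F S \<sigma> p f"
    unfolding var_seminorm_def using Q by (intro SUP_upper) auto
  then have "?s powr (1 / \<sigma>) \<le> v" using assms(3,4) by (metis ennreal_le_iff order_trans)
  then have "(?s powr (1 / \<sigma>)) powr \<sigma> \<le> v powr \<sigma>" using assms(2) by (intro powr_mono2) auto
  then have "?s \<le> v powr \<sigma>" using assms(2) by (simp add: powr_powr sum_nonneg)
  moreover have "(\<Sum>R\<in>Q. \<epsilon> powr \<sigma>) \<le> ?s"
    using Q(4) \<epsilon> assms(2) by (intro sum_mono powr_mono2) auto
  ultimately show ?thesis by simp
qed

end

text \<open>
  If the local error is at least \<open>\<epsilon>\<close> on each set of a packing, the variation bounds the number of
  these sets by \<open>(w / \<epsilon>) powr \<sigma>\<close>, so the whole space splits into about \<open>2 * \<nu> * (w / \<epsilon>) powr \<sigma>\<close>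
  pieces with errors below \<open>\<epsilon>\<close>. The value of \<open>\<epsilon>\<close> is chosen such that these take at most \<open>2 ^ j\<close>
  dictionary elements, and the total error is at most \<open>2 powr (j / p) * \<epsilon>\<close>.
\<close>

lemma jackson_inequality:
  fixes S :: "('a \<Rightarrow> 'k::{real_normed_field, euclidean_space}) set"
  assumes S: "stable_space M F S" and f: "f \<in> lp_S M F S p" and p: "p \<ge> 1" and \<sigma>: "\<sigma> > 0"
    and v: "var_seminorm M F S \<sigma> p f \<le> ennreal w" "w > 0" and j: "j \<ge> 1"
  shows "\<exists>g\<in>n_term (local_dict F S) (2 ^ j).
     lp_norm M p (space M) (\<lambda>\<omega>. f \<omega> - g \<omega>) \<le> (4 * real \<nu>) powr (1 / \<sigma>) * w * 2 powr (- real j * (1 / \<sigma> - 1 / p))"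
proof -
  have fp: "f \<in> lp_space M p" using f unfolding lp_S_def by blast
  define \<epsilon> where "\<epsilon> = w * (4 * real \<nu> / 2 ^ j) powr (1 / \<sigma>)"
  have nu: "real \<nu> > 0" using nu_ge_2 by simp
  have \<epsilon>: "\<epsilon> > 0" unfolding \<epsilon>_def using v nu by simp
  obtain m where m: "approx_by_pieces M F S p \<epsilon> f (space M) m"
    "m \<le> 1 \<or> (\<exists>Q. large_error_packing M F S p \<epsilon> f (space M) Q \<and> m \<le> 2 * \<nu> * card Q)"
    using pieces_space[OF S fp p \<epsilon> local_error_small_at_deep_level[OF S f p \<epsilon>]] by blast
  have \<epsilon>_powr: "\<epsilon> powr \<sigma> = w powr \<sigma> * (4 * real \<nu> / 2 ^ j)"
    unfolding \<epsilon>_def using v \<sigma> nu by (simp add: powr_mult powr_powr)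
  have "2 * real m \<le> 2 ^ j"
    using m(2)
  proof
    assume "m \<le> 1"
    moreover have "(2::real) ^ 1 \<le> 2 ^ j" using j by (intro power_increasing) auto
    ultimately show ?thesis by simp
  next
    assume "\<exists>Q. large_error_packing M F S p \<epsilon> f (space M) Q \<and> m \<le> 2 * \<nu> * card Q"
    then obtain Q where Q: "large_error_packing M F S p \<epsilon> f (space M) Q" "m \<le> 2 * \<nu> * card Q" by blast
    have "real (card Q) * \<epsilon> powr \<sigma> \<le> w powr \<sigma>"
      using card_bad_packing[OF S fp p \<epsilon> Q(1) \<sigma> v(1)] v(2) by simp
    then have "w powr \<sigma> * (real (card Q) * (4 * real \<nu> / 2 ^ j)) \<le> w powr \<sigma> * 1"
      unfolding \<epsilon>_powr by (simp add: mult_ac)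
    then have "real (card Q) * (4 * real \<nu> / 2 ^ j) \<le> 1"
      using v(2) by (subst (asm) mult_le_cancel_left_pos) auto
    then have "4 * real \<nu> * real (card Q) \<le> 2 ^ j" by (simp add: field_simps)
    moreover have "real m \<le> 2 * real \<nu> * real (card Q)"
      using Q(2) by (metis of_nat_le_iff of_nat_mult of_nat_numeral)
    ultimately show ?thesis by simp
  qed
  note mj = this
  obtain g where g: "g \<in> n_term (local_dict F S) (2 * m)"
    "(LINT \<omega>:space M|M. norm (f \<omega> - g \<omega>) powr p) \<le> real m * \<epsilon> powr p"
    using m(1) unfolding approx_by_pieces_def by blast
  have "real (2 * m) \<le> real (2 ^ j)"
    using mj by (simp only: of_nat_mult of_nat_power of_nat_numeral)
  then have "2 * m \<le> 2 ^ j" by (simp only: of_nat_le_iff)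
  then have "g \<in> n_term (local_dict F S) (2 ^ j)" using g(1) n_term_mono by blast
  moreover have "lp_norm M p (space M) (\<lambda>\<omega>. f \<omega> - g \<omega>) \<le> 2 powr (real j / p) * \<epsilon>"
  proof (subst lp_norm_le_iff)
    have "real m \<le> 2 powr (real j)" using mj powr_realpow[of 2 j] by linarith
    then have "real m * \<epsilon> powr p \<le> 2 powr (real j) * \<epsilon> powr p" by (intro mult_right_mono) auto
    also have "\<dots> = (2 powr (real j / p) * \<epsilon>) powr p" using p by (simp add: powr_mult powr_powr)
    finally show "(LINT \<omega>:space M|M. norm (f \<omega> - g \<omega>) powr p) \<le> (2 powr (real j / p) * \<epsilon>) powr p"
      using g(2) by linarith
  qed (use p \<epsilon> in auto)
  moreover have "2 powr (real j / p) * \<epsilon> = (4 * real \<nu>) powr (1 / \<sigma>) * w * 2 powr (- real j * (1 / \<sigma> - 1 / p))"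
  proof -
    have "(4 * real \<nu> / 2 ^ j) powr (1 / \<sigma>) = (4 * real \<nu>) powr (1 / \<sigma>) * 2 powr (- real j / \<sigma>)"
      using nu by (simp add: powr_divide powr_powr powr_minus_divide flip: powr_realpow)
    moreover have "2 powr (real j / p) * 2 powr (- real j / \<sigma>) = 2 powr (- real j * (1 / \<sigma> - 1 / p))"
      by (simp add: algebra_simps flip: powr_add)
    ultimately show ?thesis unfolding \<epsilon>_def by (simp add: mult_ac)
  qed
  ultimately show ?thesis by auto
qed

end

section \<open>An inverse estimate for the variation spaces\<close>

context nary_filtration
begin

text \<open>
  Each of the two sets either contains \<open>C\<close>, or is \<open>A - B\<close> with \<open>B \<subset> C \<subset> A\<close> and then contains
  \<open>A - C\<close>. In the first case for one of the sets, they meet inside \<open>C\<close>. In the second case for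
  both, they meet outside \<open>C\<close>, because the two outer atoms are nested.
\<close>

lemma crossing_rings_meet:
  assumes C: "C \<in> all_atoms F" and "R \<in> all_atoms F \<union> rings_of F" "R' \<in> all_atoms F \<union> rings_of F"
    and "R \<inter> C \<noteq> {}" "\<not> R \<subseteq> C" "R' \<inter> C \<noteq> {}" "\<not> R' \<subseteq> C"
  shows "R \<inter> R' \<noteq> {}"
proof -
  have outer: "\<exists>A B. R = A - B \<and> A \<in> all_atoms F \<and> C \<subset> A \<and> (B \<inter> C = {} \<or> B \<subset> C)"
    if R: "R \<in> all_atoms F \<union> rings_of F" "R \<inter> C \<noteq> {}" "\<not> R \<subseteq> C" for R
  proof -
    obtain A B where AB: "R = A - B" "A \<in> all_atoms F" "B = {} \<or> B \<in> all_atoms F"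
      using R(1) unfolding rings_of_def by blast
    have "C \<subset> A" using atoms_nested[OF AB(2) C] R(2,3) AB(1) by blast
    moreover have "B \<inter> C = {} \<or> B \<subset> C"
    proof (cases "B \<inter> C = {}")
      case False
      then have "B \<subseteq> C \<or> C \<subseteq> B" using atoms_nested[of B C] AB(3) C by auto
      moreover have "\<not> C \<subseteq> B" using R(2) AB(1) by blast
      ultimately show ?thesis by blast
    qed simp
    ultimately show ?thesis using AB by blast
  qed
  obtain A B where R: "R = A - B" "A \<in> all_atoms F" "C \<subset> A" "B \<inter> C = {} \<or> B \<subset> C"
    using outer[of R] assms by blast
  obtain A' B' where R': "R' = A' - B'" "A' \<in> all_atoms F" "C \<subset> A'" "B' \<inter> C = {} \<or> B' \<subset> C"
    using outer[of R'] assms by blast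
  have "C \<noteq> {}" using atom_nonempty[OF C] .
  then have "A \<inter> A' \<noteq> {}" using R(3) R'(3) by blast
  then have nest: "A \<subseteq> A' \<or> A' \<subseteq> A" using atoms_nested[OF R(2) R'(2)] by blast
  show ?thesis
  proof (cases "B \<inter> C = {}")
    case True
    then have "R' \<inter> C \<subseteq> R" using R by blast
    then show ?thesis using assms(6) by blast
  next
    case B: False
    show ?thesis
    proof (cases "B' \<inter> C = {}")
      case True
      then have "R \<inter> C \<subseteq> R'" using R' by blast
      then show ?thesis using assms(4) by blast
    next
      case False
      then have "B \<subseteq> C" "B' \<subseteq> C" using B R(4) R'(4) by blast+
      then have "A - C \<subseteq> R" "A' - C \<subseteq> R'" using R(1) R'(1) by blast+
      moreover have "A - C \<noteq> {}" "A' - C \<noteq> {}" using R(3) R'(3) by blast+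
      ultimately show ?thesis using nest by blast
    qed
  qed
qed

text \<open>
  On a set with nonzero local error, one of the \<open>N\<close> dictionary elements must jump, that is, its
  atom meets the set without covering it. By \<open>crossing_rings_meet\<close> no two disjoint atoms or rings
  have such a jump in common.
\<close>

lemma card_nonzero_local_errors:
  fixes S :: "('a \<Rightarrow> 'k::{real_normed_field, euclidean_space}) set"
  assumes S: "fun_vs.subspace S" and f: "f \<in> n_term (local_dict F S) N"
    and P: "\<P> \<subseteq> all_atoms F \<union> rings_of F" "disjoint \<P>"
  shows "card {R\<in>\<P>. local_error M S p f R \<noteq> 0} \<le> N"
proof -
  obtain T where T: "T \<subseteq> local_dict F S" "finite T" "card T \<le> N" "f \<in> fun_span T"
    using f unfolding n_term_def by blast
  have "\<exists>A s. t = restrict_fun A s \<and> A \<in> all_atoms F \<and> s \<in> S" if "t \<in> T" for t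
    using that T(1) unfolding local_dict_def by blast
  then obtain A s where t: "\<And>t. t \<in> T \<Longrightarrow> t = restrict_fun (A t) (s t)"
    "\<And>t. t \<in> T \<Longrightarrow> A t \<in> all_atoms F" "\<And>t. t \<in> T \<Longrightarrow> s t \<in> S" by metis
  let ?E = "{R\<in>\<P>. local_error M S p f R \<noteq> 0}"
  have "\<exists>t\<in>T. R \<inter> A t \<noteq> {} \<and> \<not> R \<subseteq> A t" if R: "R \<in> ?E" for R
  proof (rule ccontr)
    assume neg: "\<not> (\<exists>t\<in>T. R \<inter> A t \<noteq> {} \<and> \<not> R \<subseteq> A t)"
    have "T \<subseteq> {f. \<exists>s\<in>S. \<forall>\<omega>\<in>R. f \<omega> = s \<omega>}"
    proof
      fix u assume u: "u \<in> T"
      have u_app: "u \<omega> = (if \<omega> \<in> A u then s u \<omega> else 0)" for \<omega>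
        using fun_cong[OF t(1)[OF u], of \<omega>] by (simp only: restrict_fun_apply)
      from neg u consider "R \<inter> A u = {}" | "R \<subseteq> A u" by blast
      then show "u \<in> {f. \<exists>s\<in>S. \<forall>\<omega>\<in>R. f \<omega> = s \<omega>}"
      proof cases
        case 1
        then have "\<forall>\<omega>\<in>R. u \<omega> = 0 \<omega>" using u_app by auto
        then show ?thesis using fun_vs.subspace_0[OF S] by blast
      next
        case 2
        then have "\<forall>\<omega>\<in>R. u \<omega> = s u \<omega>" using u_app by auto
        then show ?thesis using t(3)[OF u] by blast
      qed
    qed
    then have "f \<in> {f. \<exists>s\<in>S. \<forall>\<omega>\<in>R. f \<omega> = s \<omega>}"
      using fun_vs.span_minimal[OF _ subspace_coincide_on[OF S]] T(4) by blast
    then obtain s where "s \<in> S" "\<And>\<omega>. \<omega> \<in> R \<Longrightarrow> f \<omega> = s \<omega>" by blast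
    then have "local_error M S p f R = 0" by (rule local_error_eq_0)
    then show False using R by simp
  qed
  then have "\<forall>R\<in>?E. \<exists>t. t \<in> T \<and> R \<inter> A t \<noteq> {} \<and> \<not> R \<subseteq> A t"
    unfolding Bex_def by (rule ballI)
  then obtain h where h0: "\<forall>R\<in>?E. h R \<in> T \<and> R \<inter> A (h R) \<noteq> {} \<and> \<not> R \<subseteq> A (h R)"
    by (rule bchoice[THEN exE])
  have h: "h R \<in> T" "R \<inter> A (h R) \<noteq> {} \<and> \<not> R \<subseteq> A (h R)" if "R \<in> ?E" for R
    using bspec[OF h0 that] by simp_all
  have "inj_on h ?E"
  proof (rule inj_onI)
    fix R R' assume R: "R \<in> ?E" "R' \<in> ?E" "h R = h R'"
    have "R \<in> \<P>" "R' \<in> \<P>" using R(1,2) by simp_all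
    moreover have "R \<inter> R' \<noteq> {}"
    proof (rule crossing_rings_meet)
      show "A (h R) \<in> all_atoms F" by (rule t(2)[OF h(1)[OF R(1)]])
      show "R \<in> all_atoms F \<union> rings_of F" "R' \<in> all_atoms F \<union> rings_of F"
        using calculation P(1) by auto
      show "R \<inter> A (h R) \<noteq> {}" "\<not> R \<subseteq> A (h R)" using h(2)[OF R(1)] by simp_all
      show "R' \<inter> A (h R) \<noteq> {}" "\<not> R' \<subseteq> A (h R)" using h(2)[OF R(2)] unfolding R(3) by simp_all
    qed
    ultimately show "R = R'" using disjointD[OF P(2), of R R'] by auto
  qed
  then have "card ?E \<le> card T"
    by (rule card_inj_on_le) (use h(1) T(2) in auto)
  then show ?thesis using T(3) by linarith
qed

end

text \<open>
  Hoelder's inequality against the constant sequence, here as Jensen's inequality for the convex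
  function \<open>x powr (p / \<sigma>)\<close>.
\<close>

lemma sum_powr_le_card_powr:
  fixes a :: "'i \<Rightarrow> real"
  assumes "finite I" "\<And>i. i \<in> I \<Longrightarrow> a i > 0" "0 < \<sigma>" "\<sigma> < p"
  shows "(\<Sum>i\<in>I. a i powr \<sigma>) powr (1 / \<sigma>) \<le> real (card I) powr (1 / \<sigma> - 1 / p) * (\<Sum>i\<in>I. a i powr p) powr (1 / p)"
proof (cases "I = {}")
  case False
  define N where "N = real (card I)"
  have N: "N > 0" using assms(1) False by (simp add: N_def card_gt_0_iff)
  define r where "r = p / \<sigma>"
  have r: "r \<ge> 1" using assms by (simp add: r_def)
  have "convex_on {0<..} (\<lambda>x::real. x powr r)" by (rule powr_convex[OF r])
  then have "(\<Sum>i\<in>I. (1 / N) *\<^sub>R (a i powr \<sigma>)) powr r \<le> (\<Sum>i\<in>I. (1 / N) * (a i powr \<sigma>) powr r)"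
    using assms False N by (intro convex_on_sum) (auto simp: N_def dest: assms(2))
  also have "(\<Sum>i\<in>I. (1 / N) *\<^sub>R (a i powr \<sigma>)) = (\<Sum>i\<in>I. a i powr \<sigma>) / N"
    by (simp add: sum_divide_distrib)
  also have "(\<Sum>i\<in>I. (1 / N) * (a i powr \<sigma>) powr r) = (\<Sum>i\<in>I. a i powr p) / N"
    using assms by (simp add: sum_divide_distrib powr_powr r_def)
  finally have "(((\<Sum>i\<in>I. a i powr \<sigma>) / N) powr r) powr (1 / p) \<le> ((\<Sum>i\<in>I. a i powr p) / N) powr (1 / p)"
    using assms by (intro powr_mono2) auto
  moreover have "r * (1 / p) = 1 / \<sigma>" using assms by (simp add: r_def)
  ultimately have "((\<Sum>i\<in>I. a i powr \<sigma>) / N) powr (1 / \<sigma>) \<le> ((\<Sum>i\<in>I. a i powr p) / N) powr (1 / p)"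
    by (simp only: powr_powr)
  then have "(\<Sum>i\<in>I. a i powr \<sigma>) powr (1 / \<sigma>) \<le> N powr (1 / \<sigma>) * ((\<Sum>i\<in>I. a i powr p) powr (1 / p) / N powr (1 / p))"
    using N by (simp add: powr_divide sum_nonneg divide_le_eq mult.commute)
  also have "\<dots> = N powr (1 / \<sigma> - 1 / p) * (\<Sum>i\<in>I. a i powr p) powr (1 / p)"
    by (simp add: powr_diff)
  finally show ?thesis by (simp only: N_def)
qed simp

text \<open>
  The variation spaces satisfy a Bernstein inequality with respect to the dictionary for every
  exponent \<open>\<sigma> < p\<close>. At most \<open>N\<close> terms of a sum in the definition of the variation are nonzero, and the
  \<open>p\<close>-th powers of the local errors are controlled by integrals over disjoint sets.
\<close>

lemma (in nary_filtration) var_seminorm_le_n_term: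
  fixes S :: "('a \<Rightarrow> 'k::{real_normed_field, euclidean_space}) set"
  assumes S: "stable_space M F S" and f: "f \<in> n_term (local_dict F S) N" and p: "p \<ge> 1" and \<sigma>: "0 < \<sigma>" "\<sigma> < p"
  shows "var_seminorm M F S \<sigma> p f \<le> ennreal (real N powr (1 / \<sigma> - 1 / p) * lp_norm M p (space M) f)"
  unfolding var_seminorm_def
proof (rule SUP_least, elim CollectE conjE, rule ennreal_leI)
  fix \<P> assume P: "finite \<P>" "\<P> \<subseteq> all_atoms F \<union> rings_of F" "disjoint \<P>"
  let ?e = "local_error M S p f"
  define E where "E = {R\<in>\<P>. ?e R \<noteq> 0}"
  have E: "finite E" "E \<subseteq> \<P>" using P(1) by (auto simp: E_def)
  have sub: "fun_vs.subspace S" using S by (rule stable_space_subspace)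
  have "S \<noteq> {}" using fun_vs.subspace_0[OF sub] by blast
  then have nonneg: "?e R \<ge> 0" for R by (rule local_error_nonneg)
  have fp: "f \<in> lp_space M p"
    using f n_term_subset_span fun_span_subset_lp_space[OF local_dict_subset_lp_space[OF S] p] p by fastforce
  have e_le: "?e R powr p \<le> (LINT \<omega>:R|M. norm (f \<omega>) powr p)" for R
  proof -
    have "?e R \<le> lp_norm M p R (\<lambda>\<omega>. f \<omega> - 0 \<omega>)"
      by (rule local_error_le_lp_norm_diff[OF fun_vs.subspace_0[OF sub]]) simp
    then have "?e R powr p \<le> lp_norm M p R f powr p" using nonneg p by (intro powr_mono2) auto
    then show ?thesis using p by (simp add: lp_norm_powr)
  qed
  have meas: "R \<in> sets M" if "R \<in> E" for R using that E P(2) ring_in_sets by blast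
  have "(\<Sum>R\<in>E. ?e R powr p) \<le> (\<Sum>R\<in>E. LINT \<omega>:R|M. norm (f \<omega>) powr p)"
    by (rule sum_mono[OF e_le])
  also have "\<dots> = (LINT \<omega>:(\<Union>R\<in>E. R)|M. norm (f \<omega>) powr p)"
  proof (rule set_integral_finite_Union[symmetric])
    show "disjoint_family_on (\<lambda>R. R) E"
      using disjointD[OF P(3)] subsetD[OF E(2)] unfolding disjoint_family_on_def by meson
  qed (use E(1) meas set_integrable_lp[OF fp] in auto)
  also have "\<dots> \<le> lp_norm M p (space M) f powr p"
  proof -
    have U: "(\<Union>R\<in>E. R) \<in> sets M" using E(1) meas by auto
    then have "lp_norm M p (\<Union>R\<in>E. R) f powr p \<le> lp_norm M p (space M) f powr p"
      using p sets.sets_into_space[OF U] fp by (intro powr_mono2 lp_norm_subset) auto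
    then show ?thesis using p by (simp add: lp_norm_powr)
  qed
  finally have "(\<Sum>R\<in>E. ?e R powr p) powr (1 / p) \<le> (lp_norm M p (space M) f powr p) powr (1 / p)"
    using p by (intro powr_mono2 sum_nonneg) auto
  then have sum_p: "(\<Sum>R\<in>E. ?e R powr p) powr (1 / p) \<le> lp_norm M p (space M) f"
    using p by (simp add: powr_powr)
  have "(\<Sum>R\<in>\<P>. ?e R powr \<sigma>) = (\<Sum>R\<in>E. ?e R powr \<sigma>)"
    using P(1) by (intro sum.mono_neutral_right) (auto simp: E_def)
  also have "(\<Sum>R\<in>E. ?e R powr \<sigma>) powr (1 / \<sigma>)
      \<le> real (card E) powr (1 / \<sigma> - 1 / p) * (\<Sum>R\<in>E. ?e R powr p) powr (1 / p)"
    using E(1) \<sigma> nonneg by (intro sum_powr_le_card_powr) (auto simp: E_def less_le)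
  also have "\<dots> \<le> real N powr (1 / \<sigma> - 1 / p) * lp_norm M p (space M) f"
    using card_nonzero_local_errors[OF sub f P(2,3), of p] \<sigma> sum_p
    by (intro mult_mono powr_mono2) (auto simp: E_def field_simps)
  finally show "(\<Sum>R\<in>\<P>. ?e R powr \<sigma>) powr (1 / \<sigma>) \<le> real N powr (1 / \<sigma> - 1 / p) * lp_norm M p (space M) f" .
qed

section \<open>Sequence norms\<close>

lemma approx_norm_infty_le:
  assumes "\<And>n. 2 powr (real n * \<alpha>) * best_approx M p D (2 ^ n) f \<le> B"
  shows "approx_norm M p D \<alpha> \<infinity> f \<le> ennreal (lp_norm M p (space M) f + B)"
proof -
  have "0 \<le> B" using assms[of 0] best_approx_nonneg[of M p D "2 ^ 0" f] by simp
  moreover have "(SUP n. ennreal \<bar>2 powr (real n * \<alpha>) * best_approx M p D (2 ^ n) f\<bar>) \<le> ennreal B"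
    using assms best_approx_nonneg[of M p D _ f] by (intro SUP_least ennreal_leI) (simp add: abs_mult)
  ultimately show ?thesis
    unfolding approx_norm_def lq_norm_def by (simp add: add_left_mono flip: infinity_ennreal_def)
qed

lemma best_approx_le_approx_norm_infty:
  assumes "approx_norm M p D \<alpha> \<infinity> f \<le> ennreal B" "B \<ge> 0"
  shows "best_approx M p D (2 ^ n) f \<le> 2 powr (- real n * \<alpha>) * B"
proof -
  let ?a = "2 powr (real n * \<alpha>) * best_approx M p D (2 ^ n) f"
  have "ennreal ?a \<le> (SUP n. ennreal \<bar>2 powr (real n * \<alpha>) * best_approx M p D (2 ^ n) f\<bar>)"
    by (intro SUP_upper2[of n]) auto
  also have "\<dots> \<le> approx_norm M p D \<alpha> \<infinity> f"
    unfolding approx_norm_def lq_norm_def by (simp flip: infinity_ennreal_def)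
  finally have "ennreal ?a \<le> ennreal B" using assms(1) by (rule order_trans)
  then have "?a \<le> B" using assms(2) by (simp add: ennreal_le_iff)
  then have "2 powr (- real n * \<alpha>) * ?a \<le> 2 powr (- real n * \<alpha>) * B" by (intro mult_left_mono) auto
  moreover have "2 powr (- real n * \<alpha>) * (2 powr (real n * \<alpha>) * b) = b" for b :: real
    by (simp add: powr_minus)
  ultimately show ?thesis by (simp only:)
qed

lemma lq_norm_term_le:
  fixes a :: "nat \<Rightarrow> real"
  assumes "lq_norm (ennreal \<tau>) a \<le> ennreal B" "B \<ge> 0" "\<tau> > 0"
  shows "\<bar>a n\<bar> \<le> B"
proof -
  define s where "s = (\<Sum>n. ennreal (\<bar>a n\<bar> powr \<tau>))"
  have le: "ennreal_powr s (1 / \<tau>) \<le> ennreal B"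
    using assms unfolding lq_norm_def s_def by simp
  then have fin: "s \<noteq> \<infinity>" by (auto simp: ennreal_powr_def top_unique)
  have term_le: "x n \<le> suminf x" for x :: "nat \<Rightarrow> ennreal"
    using sum_le_suminf[of x "{n}"] by simp
  have "ennreal (\<bar>a n\<bar> powr \<tau>) \<le> s" unfolding s_def by (rule term_le)
  then have le_s: "\<bar>a n\<bar> powr \<tau> \<le> enn2real s"
    using fin enn2real_mono[of "ennreal (\<bar>a n\<bar> powr \<tau>)" s] by (simp add: less_top)
  have "(\<bar>a n\<bar> powr \<tau>) powr (1 / \<tau>) \<le> enn2real s powr (1 / \<tau>)"
    by (rule powr_mono2[OF _ powr_ge_zero le_s]) (use assms(3) in simp)
  also have "\<dots> \<le> B"
    using le fin assms(2) unfolding ennreal_powr_def by (simp add: ennreal_le_iff)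
  finally show ?thesis using assms(3) by (simp add: powr_powr)
qed

lemma best_approx_le_approx_norm:
  assumes "approx_norm M p D \<beta> (ennreal \<tau>) f \<le> ennreal B" "B \<ge> 0" "\<tau> > 0"
  shows "best_approx M p D (2 ^ n) f \<le> 2 powr (- real n * \<beta>) * B"
proof -
  have "lq_norm (ennreal \<tau>) (\<lambda>n. 2 powr (real n * \<beta>) * best_approx M p D (2 ^ n) f) \<le> ennreal B"
    by (rule order_trans[OF _ assms(1)]) (simp add: approx_norm_def)
  from lq_norm_term_le[OF this assms(2,3), of n]
  have "2 powr (real n * \<beta>) * best_approx M p D (2 ^ n) f \<le> B" by linarith
  then have "2 powr (- real n * \<beta>) * (2 powr (real n * \<beta>) * best_approx M p D (2 ^ n) f) \<le> 2 powr (- real n * \<beta>) * B"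
    by (rule mult_left_mono) simp
  moreover have "2 powr (- real n * \<beta>) * (2 powr (real n * \<beta>) * b) = b" for b :: real
    by (simp add: powr_minus)
  ultimately show ?thesis by (simp only:)
qed

lemma sum_two_sided_geometric_le:
  fixes r :: real
  assumes "0 \<le> r" "r < 1"
  shows "(\<Sum>k<m. if k < n then r ^ (n - k) else r ^ (k - n)) \<le> 2 / (1 - r)"
proof -
  let ?c = "\<lambda>k. if k < n then r ^ (n - k) else r ^ (k - n)"
  have geo: "(\<Sum>k<m. r ^ k) \<le> 1 / (1 - r)" for m
    using assms sum_le_suminf[of "\<lambda>k. r ^ k" "{..<m}"] by (simp add: suminf_geometric)
  have "(\<Sum>k<m. ?c k) \<le> (\<Sum>k<n+m. ?c k)" using assms by (intro sum_mono2) auto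
  also have "\<dots> = (\<Sum>k<n. ?c k) + (\<Sum>k=n..<n+m. ?c k)"
    using sum.atLeastLessThan_concat[of 0 n "n + m" ?c] by (simp add: atLeast0LessThan)
  also have "(\<Sum>k=n..<n+m. ?c k) = (\<Sum>k<m. r ^ k)"
    using sum.shift_bounds_nat_ivl[of ?c 0 n m] by (simp add: atLeast0LessThan add.commute)
  also have "(\<Sum>k<n. ?c k) = (\<Sum>k<n. r ^ (n - k))" by (intro sum.cong) auto
  also have "\<dots> = (\<Sum>k<n. r ^ Suc (n - Suc k))" by (intro sum.cong) (auto simp: Suc_diff_Suc simp del: power_Suc)
  also have "\<dots> = (\<Sum>k<n. r ^ Suc k)" by (rule sum.nat_diff_reindex)
  also have "(\<Sum>k<n. r ^ Suc k) \<le> (\<Sum>k<n. r ^ k)"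
    using assms by (intro sum_mono power_decreasing) auto
  finally show ?thesis using geo[of n] geo[of m] by (simp add: field_simps)
qed

text \<open>
  The bound does not depend on the position \<open>n\<close> of the peak. It will be applied with \<open>2 ^ n\<close> the
  number of dictionary elements, so this is what makes the resulting constant uniform.
\<close>

lemma lq_norm_le_two_sided_geometric:
  fixes a :: "nat \<Rightarrow> real"
  assumes \<tau>: "\<tau> > 0" and B: "B \<ge> 0" and r: "0 \<le> r" "r < 1"
    and le: "\<And>k. \<bar>a k\<bar> powr \<tau> \<le> B powr \<tau> * (if k < n then r ^ (n - k) else r ^ (k - n))"
  shows "lq_norm (ennreal \<tau>) a \<le> ennreal (B * (2 / (1 - r)) powr (1 / \<tau>))"
proof -
  define s where "s = (\<Sum>n. ennreal (\<bar>a n\<bar> powr \<tau>))"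
  have "(\<Sum>k<m. ennreal (\<bar>a k\<bar> powr \<tau>)) \<le> ennreal (B powr \<tau> * (2 / (1 - r)))" for m
  proof -
    have "(\<Sum>k<m. \<bar>a k\<bar> powr \<tau>) \<le> (\<Sum>k<m. B powr \<tau> * (if k < n then r ^ (n - k) else r ^ (k - n)))"
      by (rule sum_mono[OF le])
    also have "\<dots> = B powr \<tau> * (\<Sum>k<m. if k < n then r ^ (n - k) else r ^ (k - n))"
      by (simp only: sum_distrib_left)
    also have "\<dots> \<le> B powr \<tau> * (2 / (1 - r))"
      by (intro mult_left_mono sum_two_sided_geometric_le r) simp
    finally show ?thesis by (simp add: ennreal_leI)
  qed
  then have s_le: "s \<le> ennreal (B powr \<tau> * (2 / (1 - r)))"
    unfolding s_def by (intro suminf_le_const summableI)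
  then have fin: "s \<noteq> \<infinity>" by (auto simp: top_unique)
  have enn_le: "enn2real s \<le> B powr \<tau> * (2 / (1 - r))"
    using r(2) s_le by (intro enn2real_leI) auto
  have "enn2real s powr (1 / \<tau>) \<le> (B powr \<tau> * (2 / (1 - r))) powr (1 / \<tau>)"
    by (rule powr_mono2[OF _ enn2real_nonneg enn_le]) (use \<tau> in simp)
  also have "\<dots> = (B powr \<tau>) powr (1 / \<tau>) * (2 / (1 - r)) powr (1 / \<tau>)" by (rule powr_mult)
  also have "(B powr \<tau>) powr (1 / \<tau>) = B" using \<tau> B by (simp add: powr_powr)
  finally have "ennreal_powr s (1 / \<tau>) \<le> ennreal (B * (2 / (1 - r)) powr (1 / \<tau>))"
    using fin by (simp add: ennreal_powr_def ennreal_leI)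
  then show ?thesis
    unfolding lq_norm_def s_def using \<tau> by simp
qed

section \<open>From the embedding to the Bernstein inequality\<close>

lemma (in nary_filtration) local_dict_span_subset_lp_S:
  fixes S :: "('a \<Rightarrow> 'k::{real_normed_field, euclidean_space}) set"
  assumes S: "stable_space M F S" and p: "p \<ge> 1"
  shows "fun_span (local_dict F S) \<subseteq> lp_S M F S p"
proof
  fix g assume g: "g \<in> fun_span (local_dict F S)"
  then have "g \<in> lp_space M p"
    using fun_span_subset_lp_space[OF local_dict_subset_lp_space[OF S] p] p by auto
  moreover have "lp_norm M p (space M) (\<lambda>\<omega>. g \<omega> - g \<omega>) = 0" by (simp add: lp_norm_def)
  ultimately show "g \<in> lp_S M F S p"
    unfolding lp_S_def using g by force
qed

text \<open>
  Let \<open>f\<close> be a sum of \<open>2 ^ n\<close> dictionary elements. By \<open>var_seminorm_le_n_term\<close> and the embedding,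
  \<open>f\<close> has approximation errors at most \<open>C * 2 powr ((n - k) * \<alpha>) * \<parallel>f\<parallel>\<close>. This is a gain over the
  required rate \<open>\<beta>\<close> for \<open>k \<ge> n\<close>, since \<open>\<alpha> > \<beta>\<close>. For \<open>k < n\<close> the trivial bound \<open>\<parallel>f\<parallel>\<close> suffices, since
  \<open>\<beta> > 0\<close>. So the weighted errors decrease geometrically on both sides of \<open>k = n\<close>, and their
  quasi-norm in \<open>\<ell>\<^sup>\<tau>\<close> is dominated by the bound at \<open>n\<close>.
\<close>

lemma (in nary_filtration) embedding_imp_bernstein:
  fixes S :: "('a \<Rightarrow> 'k::{real_normed_field, euclidean_space}) set"
  assumes S: "stable_space M F S" and p: "p > 1" and \<tau>: "0 < \<tau>" "\<tau> < p" and \<beta>: "\<beta> = 1 / \<tau> - 1 / p"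
    and \<alpha>: "\<alpha> > \<beta>" "\<alpha> = 1 / \<sigma> - 1 / p" and \<sigma>: "\<sigma> > 0"
    and emb: "cont_embedded (var_space M F S \<sigma> p) (var_norm M F S \<sigma> p)
       (approx_space M F S p D \<alpha> \<infinity>) (approx_norm M p D \<alpha> \<infinity>)"
  shows "bernstein_inequality M F S D p \<tau>"
proof -
  have \<beta>_pos: "\<beta> > 0" using \<tau> p unfolding \<beta> by (simp add: field_simps)
  then have \<alpha>_pos: "\<alpha> > 0" using \<alpha>(1) by simp
  then have \<sigma>p: "\<sigma> < p" using \<alpha>(2) \<sigma> p by (simp add: field_simps)
  obtain C0 where C0: "\<And>f. f \<in> var_space M F S \<sigma> p \<Longrightarrow>
      approx_norm M p D \<alpha> \<infinity> f \<le> ennreal C0 * var_norm M F S \<sigma> p f"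
    using emb unfolding cont_embedded_def by blast
  define C where "C = 1 + 2 * max C0 0"
  have C: "C \<ge> 1" by (simp add: C_def)
  define \<delta> where "\<delta> = min \<beta> (\<alpha> - \<beta>)"
  define r where "r = 2 powr (- \<delta> * \<tau>)"
  have \<delta>: "\<delta> > 0" "\<delta> \<le> \<beta>" "\<delta> \<le> \<alpha> - \<beta>" using \<beta>_pos \<alpha>(1) by (auto simp: \<delta>_def)
  have r: "0 \<le> r" "r < 1" using \<delta> \<tau> unfolding r_def by (auto simp: powr_less_one)
  have r_pow: "r ^ m = (2 powr (- \<delta> * real m)) powr \<tau>" for m
    unfolding r_def by (simp add: powr_powr mult_ac flip: powr_realpow)
  define K where "K = 1 + C * (2 / (1 - r)) powr (1 / \<tau>)"
  show ?thesis
    unfolding bernstein_inequality_def Let_def \<beta>[symmetric]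
  proof (intro exI[of _ K] allI impI ballI)
    fix n :: nat and f :: "'a \<Rightarrow> 'k" assume f: "f \<in> n_term (local_dict F S) (2 ^ n)"
    let ?N = "lp_norm M p (space M) f"
    let ?E = "\<lambda>k. best_approx M p D (2 ^ k) f"
    have var: "var_seminorm M F S \<sigma> p f \<le> ennreal (2 powr (real n * \<alpha>) * ?N)"
      using var_seminorm_le_n_term[OF S f _ \<sigma> \<sigma>p] p
      by (simp add: \<alpha>(2) powr_powr flip: powr_realpow)
    have "f \<in> lp_S M F S p"
      using subsetD[OF local_dict_span_subset_lp_S[OF S, of p] subsetD[OF n_term_subset_span f]] p by simp
    have var_norm: "var_norm M F S \<sigma> p f \<le> ennreal (2 * 2 powr (real n * \<alpha>) * ?N)"
    proof -
      have "(1::real) \<le> 2 powr (real n * \<alpha>)" using \<alpha>_pos by (intro ge_one_powr_ge_zero) auto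
      then have "1 * ?N \<le> 2 powr (real n * \<alpha>) * ?N" by (intro mult_right_mono) auto
      then have N_le: "ennreal ?N \<le> ennreal (2 powr (real n * \<alpha>) * ?N)" by (intro ennreal_leI) simp
      have "var_norm M F S \<sigma> p f \<le> ennreal (2 powr (real n * \<alpha>) * ?N) + ennreal (2 powr (real n * \<alpha>) * ?N)"
        unfolding var_norm_def by (rule add_mono[OF N_le var])
      also have "\<dots> = ennreal (2 * 2 powr (real n * \<alpha>) * ?N)" by (simp flip: ennreal_plus)
      finally show ?thesis .
    qed
    then have "f \<in> var_space M F S \<sigma> p"
      using \<open>f \<in> lp_S M F S p\<close> unfolding var_space_def by (auto simp: less_top[symmetric] top_unique)
    then have "approx_norm M p D \<alpha> \<infinity> f \<le> ennreal C0 * var_norm M F S \<sigma> p f" by (rule C0)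
    also have "\<dots> \<le> ennreal (max C0 0) * ennreal (2 * 2 powr (real n * \<alpha>) * ?N)"
      by (intro mult_mono var_norm ennreal_leI) auto
    also have "\<dots> = ennreal (max C0 0 * (2 * 2 powr (real n * \<alpha>) * ?N))"
      by (rule ennreal_mult[symmetric]) auto
    finally have "approx_norm M p D \<alpha> \<infinity> f \<le> ennreal (max C0 0 * (2 * 2 powr (real n * \<alpha>) * ?N))" .
    then have E_le: "?E k \<le> 2 powr (- real k * \<alpha>) * (max C0 0 * (2 * 2 powr (real n * \<alpha>) * ?N))" for k
      by (rule best_approx_le_approx_norm_infty) auto
    define B where "B = C * 2 powr (real n * \<beta>) * ?N"
    have B: "B \<ge> 0" using C by (simp add: B_def)
    \<comment> \<open>\<open>\<delta>\<close> is the smaller one of the rates of decrease on the two sides.\<close>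
    have main: "2 powr (real k * \<beta>) * ?E k \<le> B * 2 powr (- \<delta> * (if k < n then real (n - k) else real (k - n)))" for k
    proof (cases "k < n")
      case True
      have "2 powr (real k * \<beta>) * ?E k \<le> 2 powr (real k * \<beta>) * ?N"
        by (intro mult_left_mono best_approx_le_norm) auto
      also have "\<dots> \<le> 2 powr (real n * \<beta> + - \<delta> * real (n - k)) * ?N"
      proof (intro mult_right_mono powr_mono)
        have "\<delta> * real (n - k) \<le> \<beta> * real (n - k)" using \<delta> by (intro mult_right_mono) auto
        then show "real k * \<beta> \<le> real n * \<beta> + - \<delta> * real (n - k)" using True by (simp add: of_nat_diff algebra_simps)
      qed auto
      also have "\<dots> = 1 * (2 powr (real n * \<beta>) * ?N * 2 powr (- \<delta> * real (n - k)))"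
        by (simp only: powr_add mult_ac mult_1)
      also have "\<dots> \<le> C * (2 powr (real n * \<beta>) * ?N * 2 powr (- \<delta> * real (n - k)))"
        by (intro mult_right_mono C) auto
      finally show ?thesis using True by (simp add: B_def mult_ac)
    next
      case False
      have "2 powr (real k * \<beta>) * ?E k
          \<le> 2 powr (real k * \<beta>) * (2 powr (- real k * \<alpha>) * (max C0 0 * (2 * 2 powr (real n * \<alpha>) * ?N)))"
        by (intro mult_left_mono E_le) auto
      also have "\<dots> = 2 * max C0 0 * (2 powr (real k * \<beta> + - real k * \<alpha> + real n * \<alpha>) * ?N)"
        by (simp only: powr_add mult_ac)
      also have "\<dots> \<le> C * (2 powr (real n * \<beta> + - \<delta> * real (k - n)) * ?N)"
      proof (intro mult_mono mult_right_mono powr_mono)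
        have "\<delta> * real (k - n) \<le> (\<alpha> - \<beta>) * real (k - n)" using \<delta> by (intro mult_right_mono) auto
        then show "real k * \<beta> + - real k * \<alpha> + real n * \<alpha> \<le> real n * \<beta> + - \<delta> * real (k - n)"
          using False by (simp add: of_nat_diff algebra_simps)
      qed (auto simp: C_def)
      also have "\<dots> = B * 2 powr (- \<delta> * real (k - n))"
        unfolding B_def by (simp only: powr_add mult_ac)
      finally show ?thesis using False by simp
    qed
    have nonneg: "2 powr (real k * \<beta>) * ?E k \<ge> 0" for k using best_approx_nonneg[of M p D "2 ^ k" f] by simp
    have "lq_norm (ennreal \<tau>) (\<lambda>k. 2 powr (real k * \<beta>) * ?E k) \<le> ennreal (B * (2 / (1 - r)) powr (1 / \<tau>))"
    proof (rule lq_norm_le_two_sided_geometric[OF \<tau>(1) B r])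
      fix k
      have "\<bar>2 powr (real k * \<beta>) * ?E k\<bar> powr \<tau>
          \<le> (B * 2 powr (- \<delta> * (if k < n then real (n - k) else real (k - n)))) powr \<tau>"
        using nonneg[of k] main[of k] \<tau> by (intro powr_mono2) (simp_all only: abs_of_nonneg less_imp_le)
      also have "\<dots> = B powr \<tau> * (if k < n then r ^ (n - k) else r ^ (k - n))"
        unfolding r_pow powr_mult by (simp only: if_distrib split: if_splits) simp
      finally show "\<bar>2 powr (real k * \<beta>) * ?E k\<bar> powr \<tau> \<le> B powr \<tau> * (if k < n then r ^ (n - k) else r ^ (k - n))" .
    qed
    then have "approx_norm M p D \<beta> (ennreal \<tau>) f \<le> ennreal ?N + ennreal (B * (2 / (1 - r)) powr (1 / \<tau>))"
      unfolding approx_norm_def by (rule add_left_mono)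
    also have "\<dots> = ennreal (?N + B * (2 / (1 - r)) powr (1 / \<tau>))"
      using B by (intro ennreal_plus[symmetric]) auto
    also have "\<dots> \<le> ennreal (K * 2 powr (real n * \<beta>) * ?N)"
    proof (rule ennreal_leI)
      have "(1::real) \<le> 2 powr (real n * \<beta>)" using \<beta>_pos by (intro ge_one_powr_ge_zero) auto
      then have "1 * ?N \<le> 2 powr (real n * \<beta>) * ?N" by (intro mult_right_mono) auto
      then show "?N + B * (2 / (1 - r)) powr (1 / \<tau>) \<le> K * 2 powr (real n * \<beta>) * ?N"
        unfolding K_def B_def by (simp add: algebra_simps)
    qed
    finally show "approx_norm M p D \<beta> (ennreal \<tau>) f \<le> ennreal (K * 2 powr (real n * \<beta>) * ?N)" .
  qed
qed

section \<open>The embedding under the Bernstein inequality\<close>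

text \<open>
  Along \<open>k\<close> the exponent drops by one only every \<open>d\<close> steps. This slow decrease still keeps the
  total of the powers within a constant factor of the first of them.
\<close>

lemma sum_two_power_div_le:
  fixes d J :: nat
  assumes "d > 0"
  shows "(\<Sum>k<J. 2 ^ (J - k div d)) \<le> d * (2 * 2 ^ J)"
proof -
  have block: "(\<Sum>k<d * q. 2 ^ (J - k div d)) = d * (\<Sum>i<q. 2 ^ (J - i))" for q
  proof (induction q)
    case (Suc q)
    have "(\<Sum>k<d * Suc q. 2 ^ (J - k div d)) = (\<Sum>k<d * q. 2 ^ (J - k div d)) + (\<Sum>k=d*q..<d*q+d. 2 ^ (J - k div d) :: nat)"
      using sum.atLeastLessThan_concat[of 0 "d * q" "d * q + d" "\<lambda>k. 2 ^ (J - k div d) :: nat"]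
      by (simp add: atLeast0LessThan algebra_simps)
    also have "(\<Sum>k=d*q..<d*q+d. 2 ^ (J - k div d)) = (\<Sum>k=d*q..<d*q+d. 2 ^ (J - q) :: nat)"
    proof (intro sum.cong refl)
      fix k assume k: "k \<in> {d * q..<d * q + d}"
      then have "k div d = q" using assms by (intro div_nat_eqI) (auto simp: algebra_simps)
      then show "(2::nat) ^ (J - k div d) = 2 ^ (J - q)" by simp
    qed
    finally show ?case using Suc by (simp add: algebra_simps)
  qed simp
  have "(\<Sum>k<J. 2 ^ (J - k div d) :: nat) \<le> (\<Sum>k<d * J. 2 ^ (J - k div d))"
    using assms by (intro sum_mono2) auto
  also have "\<dots> = d * (\<Sum>i<J. 2 ^ (J - i))" by (rule block)
  also have "(\<Sum>i<J. 2 ^ (J - i) :: nat) = (\<Sum>i<J. 2 ^ Suc (J - Suc i))"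
    by (intro sum.cong) (auto simp: Suc_diff_Suc simp del: power_Suc)
  also have "\<dots> = (\<Sum>i<J. 2 ^ Suc i)" by (rule sum.nat_diff_reindex)
  also have "\<dots> = 2 * (\<Sum>i<J. 2 ^ i)" by (simp add: sum_distrib_left)
  also have "\<dots> \<le> 2 * 2 ^ J"
    using sum_power2[of J] by (simp add: atLeast0LessThan)
  finally show ?thesis by simp
qed

text \<open>
  Let \<open>g j\<close> be the approximants of \<open>jackson_inequality\<close>, and write \<open>f\<close> as \<open>f - g J\<close> plus
  the sum of the differences \<open>h j = g (Suc j) - g j\<close> for \<open>j < J\<close>. Each \<open>h j\<close> is a sum of at most
  \<open>2 ^ (j + 2)\<close> dictionary elements of norm about \<open>2 powr (- j * \<alpha>)\<close>, so by the Bernstein inequality it can be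
  approximated by \<open>2 ^ i\<close> elements of \<open>D\<close> up to about \<open>2 powr ((j - i) * \<beta> - j * \<alpha>)\<close>.

  The number of terms is distributed over the differences as follows: the difference \<open>k\<close> places
  before the last one gets \<open>2 ^ (J - k div d)\<close> terms. With \<open>i = J\<close> for all of them the errors would
  sum up, thanks to \<open>\<alpha> < \<beta>\<close>, but there would be \<open>J * 2 ^ J\<close> terms; with \<open>d = 1\<close> there would
  be few enough terms, but the errors would grow with \<open>k\<close>. For \<open>d \<ge> 2 * \<beta> / (\<beta> - \<alpha>)\<close> both
  sums are geometric.
\<close>

lemma (in nary_filtration) bernstein_imp_embedding:
  fixes S :: "('a \<Rightarrow> 'k::{real_normed_field, euclidean_space}) set"
  assumes S: "stable_space M F S" and p: "p > 1" and D: "D \<subseteq> lp_space M p"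
    and \<tau>: "0 < \<tau>" and \<beta>: "\<beta> = 1 / \<tau> - 1 / p"
    and \<alpha>: "0 < \<alpha>" "\<alpha> < \<beta>" "\<alpha> = 1 / \<sigma> - 1 / p" and \<sigma>: "\<sigma> > 0"
    and BI: "bernstein_inequality M F S D p \<tau>"
  shows "cont_embedded (var_space M F S \<sigma> p) (var_norm M F S \<sigma> p)
       (approx_space M F S p D \<alpha> \<infinity>) (approx_norm M p D \<alpha> \<infinity>)"
proof -
  have p1: "p \<ge> 1" using p by simp
  let ?norm = "lp_norm M p (space M)"
  obtain C0 where C0: "\<And>n f. n \<ge> 1 \<Longrightarrow> f \<in> n_term (local_dict F S) (2 ^ n) \<Longrightarrow>
      approx_norm M p D \<beta> (ennreal \<tau>) f \<le> ennreal (C0 * 2 powr (real n * \<beta>) * ?norm f)"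
    using BI unfolding bernstein_inequality_def Let_def \<beta>[symmetric] by blast
  define C where "C = max C0 0"
  have C: "C \<ge> 0" by (simp add: C_def)
  have bern: "best_approx M p D (2 ^ i) f \<le> 2 powr (- real i * \<beta>) * (C * 2 powr (real n * \<beta>) * ?norm f)"
    if "n \<ge> 1" "f \<in> n_term (local_dict F S) (2 ^ n)" for n i f
  proof (rule best_approx_le_approx_norm)
    have "C0 * 2 powr (real n * \<beta>) * ?norm f \<le> C * 2 powr (real n * \<beta>) * ?norm f"
      unfolding C_def by (intro mult_right_mono) auto
    then show "approx_norm M p D \<beta> (ennreal \<tau>) f \<le> ennreal (C * 2 powr (real n * \<beta>) * ?norm f)"
      using C0[OF that] by (meson ennreal_leI order_trans)
  qed (use C \<tau> in auto)
  define G where "G = 1 + (4 * real \<nu>) powr (1 / \<sigma>)"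
  have G: "G \<ge> 1" by (simp add: G_def)
  define d where "d = nat \<lceil>2 * \<beta> / (\<beta> - \<alpha>)\<rceil> + 1"
  define \<gamma> where "\<gamma> = (\<beta> - \<alpha>) / 2"
  have \<gamma>: "\<gamma> > 0" using \<alpha> by (simp add: \<gamma>_def)
  have d_pos: "d > 0" by (simp add: d_def)
  have d: "\<beta> / real d \<le> \<gamma>"
  proof -
    have "2 * \<beta> / (\<beta> - \<alpha>) \<le> real d" unfolding d_def by linarith
    then show ?thesis using \<alpha>(2) d_pos unfolding \<gamma>_def by (simp add: field_simps)
  qed
  define r where "r = 2 powr (- \<gamma>)"
  have r: "0 \<le> r" "r < 1" using \<gamma> unfolding r_def by (auto simp: powr_less_one)
  define H where "H = C * 2 powr \<beta> * (G * (1 + 2 powr \<alpha>))"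
  have H: "H \<ge> 0" using C G by (simp add: H_def)
  define L where "L = G + H / (1 - r)"
  have "0 \<le> H / (1 - r)" using H r by (intro divide_nonneg_pos) auto
  then have L: "L \<ge> 1" using G unfolding L_def by linarith
  \<comment> \<open>All \<open>2 ^ (J - k div d)\<close> together are at most \<open>2 * d * 2 ^ J \<le> 2 ^ (c + J)\<close>.\<close>
  define c where "c = 2 * d"
  have bound: "2 powr (real n * \<alpha>) * best_approx M p D (2 ^ n) f \<le> L * 2 powr (real c * \<alpha>) * w"
    if f: "f \<in> lp_S M F S p" and v: "var_seminorm M F S \<sigma> p f \<le> ennreal w" and Nw: "?norm f \<le> w" and w: "w > 0"
    for f w n
  proof (cases "n < c")
    case True
    have "2 powr (real n * \<alpha>) * best_approx M p D (2 ^ n) f \<le> 2 powr (real c * \<alpha>) * w"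
      using True \<alpha> Nw best_approx_le_norm[of M p D "2 ^ n" f]
      by (intro mult_mono powr_mono mult_right_mono) (auto intro: best_approx_nonneg)
    also have "\<dots> \<le> L * (2 powr (real c * \<alpha>) * w)"
      using mult_right_mono[OF L, of "2 powr (real c * \<alpha>) * w"] w by simp
    finally show ?thesis by (simp add: mult_ac)
  next
    case False
    define J where "J = n - c"
    have fp: "f \<in> lp_space M p" using f unfolding lp_S_def by blast
    \<comment> \<open>\<open>g 0 = 0\<close> lets the differences telescope to \<open>g J\<close>. The bound for it is the trivial one.\<close>
    have "\<exists>g\<in>n_term (local_dict F S) (2 ^ j). ?norm (\<lambda>\<omega>. f \<omega> - g \<omega>) \<le> G * w * 2 powr (- real j * \<alpha>) \<and> (j = 0 \<longrightarrow> g = (\<lambda>_. 0))" for j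
    proof (cases "j = 0")
      case True
      have "?norm f \<le> G * w" using Nw mult_right_mono[OF G less_imp_le[OF w]] by linarith
      then show ?thesis using True zero_in_n_term by (intro bexI[of _ "\<lambda>_. 0"]) auto
    next
      case False
      then obtain g where g: "g \<in> n_term (local_dict F S) (2 ^ j)"
        "?norm (\<lambda>\<omega>. f \<omega> - g \<omega>) \<le> (4 * real \<nu>) powr (1 / \<sigma>) * w * 2 powr (- real j * \<alpha>)"
        using jackson_inequality[OF S f p1 \<sigma> v w, of j] unfolding \<alpha>(3) by auto
      have "(4 * real \<nu>) powr (1 / \<sigma>) * w * 2 powr (- real j * \<alpha>) \<le> G * w * 2 powr (- real j * \<alpha>)"
        using w unfolding G_def by (intro mult_right_mono) auto
      then show ?thesis using g False by (intro bexI[of _ g]) auto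
    qed
    then obtain g where g: "\<And>j. g j \<in> n_term (local_dict F S) (2 ^ j)"
      "\<And>j. ?norm (\<lambda>\<omega>. f \<omega> - g j \<omega>) \<le> G * w * 2 powr (- real j * \<alpha>)" "g 0 = (\<lambda>_. 0)" by metis
    have gp: "g j \<in> lp_space M p" for j
      using g(1)[of j] n_term_subset_span fun_span_subset_lp_space[OF local_dict_subset_lp_space[OF S] p1] p by fastforce
    define h where "h j = (\<lambda>\<omega>. g (Suc j) \<omega> - g j \<omega>)" for j
    have hp: "h j \<in> lp_space M p" for j unfolding h_def by (intro lp_space_diff gp p1)
    have h_term: "h j \<in> n_term (local_dict F S) (2 ^ (j + 2))" for j
      using n_term_diff[OF g(1)[of "Suc j"] g(1)[of j]] n_term_mono[of "2 ^ Suc j + 2 ^ j" "2 ^ (j + 2)" "local_dict F S"]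
      unfolding h_def by auto
    have h_norm: "?norm (h j) \<le> G * (1 + 2 powr \<alpha>) * w * 2 powr (- real (Suc j) * \<alpha>)" for j
    proof -
      have "?norm (h j) \<le> ?norm (\<lambda>\<omega>. g (Suc j) \<omega> - f \<omega>) + ?norm (\<lambda>\<omega>. f \<omega> - g j \<omega>)"
        unfolding h_def by (rule lp_norm_triangle_diff[OF gp fp gp p1])
      also have "?norm (\<lambda>\<omega>. g (Suc j) \<omega> - f \<omega>) = ?norm (\<lambda>\<omega>. f \<omega> - g (Suc j) \<omega>)"
        by (rule lp_norm_minus_commute)
      also have "\<dots> + ?norm (\<lambda>\<omega>. f \<omega> - g j \<omega>) \<le> G * w * 2 powr (- real (Suc j) * \<alpha>) + G * w * 2 powr (- real j * \<alpha>)"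
        by (intro add_mono g(2))
      also have "2 powr (- real j * \<alpha>) = 2 powr \<alpha> * 2 powr (- real (Suc j) * \<alpha>)"
        by (simp add: algebra_simps flip: powr_add)
      finally show ?thesis by (simp add: algebra_simps)
    qed
    \<comment> \<open>Here \<open>k\<close> counts the differences backwards, so that \<open>k = 0\<close> belongs to \<open>h (J - 1)\<close>.\<close>
    define i where "i k = J - k div d" for k
    have h_approx: "best_approx M p D (2 ^ i k) (h (J - Suc k)) \<le> H * w * 2 powr (- real J * \<alpha>) * r ^ k" if "k < J" for k
    proof -
      define j where "j = J - Suc k"
      have J: "J = Suc j + k" using that by (simp add: j_def)
      have kd: "k div d \<le> J" using that by (meson div_le_dividend le_trans less_imp_le)
      have "best_approx M p D (2 ^ i k) (h j) \<le> 2 powr (- real (i k) * \<beta>) * (C * 2 powr (real (j + 2) * \<beta>) * ?norm (h j))"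
        using bern[OF _ h_term[of j]] by simp
      also have "\<dots> \<le> 2 powr (- real (i k) * \<beta>) * (C * 2 powr (real (j + 2) * \<beta>) * (G * (1 + 2 powr \<alpha>) * w * 2 powr (- real (Suc j) * \<alpha>)))"
        using C by (intro mult_left_mono h_norm) auto
      also have "\<dots> = H * w * 2 powr (- real (i k) * \<beta> + real (Suc j) * (\<beta> - \<alpha>))"
      proof -
        have exponents: "2 powr (- real (i k) * \<beta> + real (Suc j) * (\<beta> - \<alpha>)) * 2 powr \<beta>
            = 2 powr (- real (i k) * \<beta>) * 2 powr (real (j + 2) * \<beta>) * 2 powr (- real (Suc j) * \<alpha>)"
          by (simp add: algebra_simps flip: powr_add)
        have "2 powr (- real (i k) * \<beta>) * (C * 2 powr (real (j + 2) * \<beta>) * (G * (1 + 2 powr \<alpha>) * w * 2 powr (- real (Suc j) * \<alpha>)))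
            = (2 powr (- real (i k) * \<beta>) * 2 powr (real (j + 2) * \<beta>) * 2 powr (- real (Suc j) * \<alpha>)) * (C * (G * (1 + 2 powr \<alpha>)) * w)"
          by (simp only: mult_ac)
        also have "\<dots> = (2 powr (- real (i k) * \<beta> + real (Suc j) * (\<beta> - \<alpha>)) * 2 powr \<beta>) * (C * (G * (1 + 2 powr \<alpha>)) * w)"
          by (simp only: exponents)
        also have "\<dots> = H * w * 2 powr (- real (i k) * \<beta> + real (Suc j) * (\<beta> - \<alpha>))"
          unfolding H_def by (simp only: mult_ac)
        finally show ?thesis .
      qed
      also have "\<dots> \<le> H * w * 2 powr (- real J * \<alpha> + - \<gamma> * real k)"
      proof (intro mult_left_mono powr_mono)
        have "real (k div d) \<le> real k / real d" by (rule of_nat_div_le_of_nat)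
        then have "\<beta> * real (k div d) \<le> \<beta> * (real k / real d)" using \<alpha> by (intro mult_left_mono) auto
        also have "\<dots> = \<beta> / real d * real k" by simp
        also have "\<dots> \<le> \<gamma> * real k" by (rule mult_right_mono[OF d]) simp
        finally have "\<beta> * real (k div d) \<le> \<gamma> * real k" .
        moreover have "- real (i k) * \<beta> + real (Suc j) * (\<beta> - \<alpha>) = - real J * \<alpha> + \<beta> * real (k div d) - (\<beta> - \<alpha>) * real k"
          using kd unfolding i_def by (simp add: of_nat_diff J algebra_simps)
        ultimately show "- real (i k) * \<beta> + real (Suc j) * (\<beta> - \<alpha>) \<le> - real J * \<alpha> + - \<gamma> * real k"
          unfolding \<gamma>_def by (simp add: field_simps)
      qed (use H w in auto)
      also have "\<dots> = H * w * 2 powr (- real J * \<alpha>) * r ^ k"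
        unfolding r_def powr_add by (simp add: powr_powr flip: powr_realpow)
      finally show ?thesis unfolding j_def .
    qed
    define G' where "G' = (\<Sum>k<J. 2 ^ i k :: nat)"
    have gJ: "g J = (\<lambda>\<omega>. \<Sum>k<J. h (J - Suc k) \<omega>)"
    proof
      fix \<omega>
      have "(\<Sum>k<J. h (J - Suc k) \<omega>) = (\<Sum>k<J. h k \<omega>)" by (rule sum.nat_diff_reindex)
      also have "\<dots> = g J \<omega> - g 0 \<omega>" unfolding h_def by (rule sum_lessThan_telescope)
      finally show "g J \<omega> = (\<Sum>k<J. h (J - Suc k) \<omega>)" using g(3) by simp
    qed
    have "best_approx M p D G' (g J) \<le> (\<Sum>k<J. best_approx M p D (2 ^ i k) (h (J - Suc k)))"
      using best_approx_sum[of "{..<J}" "\<lambda>k. h (J - Suc k)" M p D "\<lambda>k. 2 ^ i k"] hp D p1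
      unfolding gJ G'_def by auto
    also have "\<dots> \<le> (\<Sum>k<J. H * w * 2 powr (- real J * \<alpha>) * r ^ k)"
      by (intro sum_mono h_approx) auto
    also have "\<dots> = H * w * 2 powr (- real J * \<alpha>) * (\<Sum>k<J. r ^ k)" by (rule sum_distrib_left[symmetric])
    also have "\<dots> \<le> H * w * 2 powr (- real J * \<alpha>) * (1 / (1 - r))"
    proof (intro mult_left_mono)
      show "(\<Sum>k<J. r ^ k) \<le> 1 / (1 - r)"
        using r sum_le_suminf[of "\<lambda>k. r ^ k" "{..<J}"] by (simp add: suminf_geometric)
    qed (use H w in auto)
    finally have sum_part: "best_approx M p D G' (g J) \<le> H / (1 - r) * w * 2 powr (- real J * \<alpha>)" by simp
    have "G' \<le> 2 ^ n"
    proof -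
      have "G' \<le> d * (2 * 2 ^ J)" unfolding G'_def i_def by (rule sum_two_power_div_le[OF d_pos])
      also have "\<dots> = c * 2 ^ J" by (simp add: c_def)
      also have "\<dots> \<le> 2 ^ c * 2 ^ J" using less_exp[of c] by (intro mult_right_mono) auto
      also have "\<dots> = 2 ^ n" using False by (simp add: J_def flip: power_add)
      finally show ?thesis .
    qed
    then have "best_approx M p D (2 ^ n) f \<le> best_approx M p D (0 + G') (\<lambda>\<omega>. (f \<omega> - g J \<omega>) + g J \<omega>)"
      using best_approx_antimono[of G' "2 ^ n" M p D f] by simp
    also have "\<dots> \<le> best_approx M p D 0 (\<lambda>\<omega>. f \<omega> - g J \<omega>) + best_approx M p D G' (g J)"
      by (rule best_approx_add[OF lp_space_diff[OF fp gp p1] gp D p1])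
    also have "\<dots> \<le> G * w * 2 powr (- real J * \<alpha>) + H / (1 - r) * w * 2 powr (- real J * \<alpha>)"
      by (intro add_mono sum_part order_trans[OF best_approx_le_norm g(2)])
    also have "\<dots> = L * w * 2 powr (- real J * \<alpha>)" by (simp add: L_def algebra_simps)
    finally have "2 powr (real n * \<alpha>) * best_approx M p D (2 ^ n) f \<le> 2 powr (real n * \<alpha>) * (L * w * 2 powr (- real J * \<alpha>))"
      by (intro mult_left_mono) auto
    also have "\<dots> = L * w * (2 powr (real n * \<alpha>) * 2 powr (- real J * \<alpha>))" by (simp only: mult_ac)
    also have "2 powr (real n * \<alpha>) * 2 powr (- real J * \<alpha>) = 2 powr (real c * \<alpha>)"
      using False by (simp add: J_def of_nat_diff algebra_simps flip: powr_add)
    finally show ?thesis by (simp only: mult_ac)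
  qed
  define K where "K = 1 + L * 2 powr (real c * \<alpha>)"
  have K: "K \<ge> 0" using L by (simp add: K_def)
  have main: "approx_norm M p D \<alpha> \<infinity> f \<le> ennreal K * var_norm M F S \<sigma> p f" if "f \<in> var_space M F S \<sigma> p" for f
  proof -
    have f: "f \<in> lp_S M F S p" and fin: "var_norm M F S \<sigma> p f < \<infinity>" using that unfolding var_space_def by auto
    define x where "x = enn2real (var_norm M F S \<sigma> p f)"
    have x: "var_norm M F S \<sigma> p f = ennreal x" "x \<ge> 0" using fin by (auto simp: x_def less_top)
    have "var_seminorm M F S \<sigma> p f \<le> ennreal x" "ennreal (?norm f) \<le> ennreal x"
      unfolding x(1)[symmetric] var_norm_def by auto
    then have v: "var_seminorm M F S \<sigma> p f \<le> ennreal x" "?norm f \<le> x" using x(2) by (auto simp: ennreal_le_iff)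
    have bnd: "2 powr (real n * \<alpha>) * best_approx M p D (2 ^ n) f \<le> L * 2 powr (real c * \<alpha>) * x" for n
    \<comment> \<open>For norm zero the errors vanish; otherwise the norm itself serves as \<open>w\<close>.\<close>
    proof (cases "x = 0")
      case True
      then have "best_approx M p D (2 ^ n) f \<le> 0" using best_approx_le_norm[of M p D "2 ^ n" f] v by simp
      then show ?thesis using True by (simp add: mult_le_0_iff)
    next
      case False
      then show ?thesis using bound[OF f v] x(2) by simp
    qed
    have "approx_norm M p D \<alpha> \<infinity> f \<le> ennreal (?norm f + L * 2 powr (real c * \<alpha>) * x)"
      by (rule approx_norm_infty_le[OF bnd])
    also have "\<dots> \<le> ennreal (K * x)" using v by (intro ennreal_leI) (simp add: K_def algebra_simps)
    also have "\<dots> = ennreal K * var_norm M F S \<sigma> p f" using K x by (simp add: ennreal_mult)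
    finally show ?thesis .
  qed
  have "var_space M F S \<sigma> p \<subseteq> approx_space M F S p D \<alpha> \<infinity>"
  proof
    fix f assume f: "f \<in> var_space M F S \<sigma> p"
    then have "ennreal K * var_norm M F S \<sigma> p f < \<infinity>" unfolding var_space_def
      by (auto simp: ennreal_mult_less_top)
    then show "f \<in> approx_space M F S p D \<alpha> \<infinity>"
      using f main[OF f] unfolding var_space_def approx_space_def by auto
  qed
  then show ?thesis unfolding cont_embedded_def using main by blast
qed

theorem theorem4p5:
  fixes M :: "'a measure" and F :: "nat \<Rightarrow> 'a measure" and \<nu> :: nat
    and S :: "('a \<Rightarrow> 'k::{real_normed_field, euclidean_space}) set"
    and \<Phi> :: "nat \<Rightarrow> ('a \<Rightarrow> 'k) set"
    and p \<tau> \<beta> :: real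
  assumes filtration: "nary_filtration M F \<nu>"
    and S: "stable_space M F S"
    and \<Phi>: "local_orthonormal_system M F S \<Phi>"
    and greedy: "\<And>r::real. 1 < r \<Longrightarrow> greedy_temlyakov_system M r (lp_S M F S r) (\<Union>n. \<Phi> n)"
    and p: "1 < p" and \<tau>: "0 < \<tau>" "\<tau> < p" and \<beta>: "\<beta> = 1 / \<tau> - 1 / p"
  shows "(\<not> bernstein_inequality M F S (\<Union>n. \<Phi> n) p \<tau> \<longrightarrow>
            (\<forall>\<alpha> \<sigma>. \<alpha> > \<beta> \<and> \<sigma> > 0 \<and> \<alpha> = 1 / \<sigma> - 1 / p \<longrightarrow>
              \<not> cont_embedded (var_space M F S \<sigma> p) (var_norm M F S \<sigma> p)
                  (approx_space M F S p (\<Union>n. \<Phi> n) \<alpha> \<infinity>)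
                  (approx_norm M p (\<Union>n. \<Phi> n) \<alpha> \<infinity>)))
       \<and> (bernstein_inequality M F S (\<Union>n. \<Phi> n) p \<tau> \<longrightarrow>
            (\<forall>\<alpha> \<sigma>. 0 < \<alpha> \<and> \<alpha> < \<beta> \<and> \<sigma> > 0 \<and> \<alpha> = 1 / \<sigma> - 1 / p \<longrightarrow>
              cont_embedded (var_space M F S \<sigma> p) (var_norm M F S \<sigma> p)
                  (approx_space M F S p (\<Union>n. \<Phi> n) \<alpha> \<infinity>)
                  (approx_norm M p (\<Union>n. \<Phi> n) \<alpha> \<infinity>)))"
proof -
  interpret nary_filtration M F \<nu> by (rule filtration)
  have D: "(\<Union>n. \<Phi> n) \<subseteq> lp_space M p"
    using local_orthonormal_system_subset_lp_space[OF S \<Phi>] p by simp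
  show ?thesis
  proof (intro conjI impI allI; elim conjE)
    fix \<alpha> \<sigma> :: real
    assume neg: "\<not> bernstein_inequality M F S (\<Union>n. \<Phi> n) p \<tau>" and "\<beta> < \<alpha>" "\<alpha> = 1 / \<sigma> - 1 / p" "0 < \<sigma>"
    then show "\<not> cont_embedded (var_space M F S \<sigma> p) (var_norm M F S \<sigma> p)
         (approx_space M F S p (\<Union>n. \<Phi> n) \<alpha> \<infinity>) (approx_norm M p (\<Union>n. \<Phi> n) \<alpha> \<infinity>)"
      using embedding_imp_bernstein[OF S p \<tau> \<beta>, of \<alpha> \<sigma> "\<Union>n. \<Phi> n"] by blast
  next
    fix \<alpha> \<sigma> :: real
    assume "bernstein_inequality M F S (\<Union>n. \<Phi> n) p \<tau>" "0 < \<alpha>" "\<alpha> < \<beta>" "0 < \<sigma>" "\<alpha> = 1 / \<sigma> - 1 / p"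
    then show "cont_embedded (var_space M F S \<sigma> p) (var_norm M F S \<sigma> p)
         (approx_space M F S p (\<Union>n. \<Phi> n) \<alpha> \<infinity>) (approx_norm M p (\<Union>n. \<Phi> n) \<alpha> \<infinity>)"
      using bernstein_imp_embedding[OF S p D \<tau>(1) \<beta>] by blast
  qed
qed

end
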